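(* Let $X(t,\omega)$, $t\in\mathbb{R}$, be a symmetric stable process of index $\gamma$, $1<\gamma\le 2$, and let $f\in L^1(\mathbb{R})\cap L^{\gamma}(\mathbb{R})$. Then the stochastic integral $\int_{-\infty}^{\infty}f(t)\,dX(t,\omega)$ exists in the sense of convergence in mean; that is, the random variables $Y_n=\int_{-n}^{n}f(t)\,dX(t,\omega)$ converge in $L^1(\Omega)$ as $n\to\infty$, and $\int_{-\infty}^{\infty}f(t)\,dX(t,\omega)$ denotes their limit.
   Context: A symmetric stable process of index $\gamma$ is a real-valued process $X(t,\omega)$, $t\in\mathbb{R}$, with independent increments such that $E\,e^{iu(X(t)-X(s))}=\exp(-c|t-s||u|^{\gamma})$ for all $s,t,u\in\mathbb{R}$, where $c>0$ is a constant. For a bounded interval $[a,b]$ and $f\in L^p[a,b]$, $p\ge\gamma$, the stochastic integral $\int_a^b f(t)\,dX(t,\omega)$ is defined in the sense of convergence in mean, i.e. as the $L^1(\Omega)$ limit of the integrals of step functions converging to $f$ in $L^{\gamma}[a,b]$, where the integral of a step function $\sum_j c_j\chi_{(t_j,t_{j+1}]}$ is $\sum_j c_j(X(t_{j+1})-X(t_j))$. *)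

theory Defs
  imports "HOL-Probability.Probability"
begin

definition Lp_mem :: "'a measure \<Rightarrow> real \<Rightarrow> ('a \<Rightarrow> 'b::{real_normed_field, euclidean_space}) \<Rightarrow> bool" where
  "Lp_mem M p f \<longleftrightarrow> f \<in> borel_measurable M \<and> integrable M (\<lambda>x. norm (f x) powr p)"

definition Lp_norm :: "'a measure \<Rightarrow> real \<Rightarrow> ('a \<Rightarrow> 'b::{real_normed_field, euclidean_space}) \<Rightarrow> real" where
  "Lp_norm M p f = (LINT x|M. norm (f x) powr p) powr (1 / p)"

(* The membership requirements matter: the Bochner integral of a non-integrable function is 0,
   so the norm condition alone would be satisfied by spurious limits. *)
definition Lp_tendsto ::
    "'a measure \<Rightarrow> real \<Rightarrow> (nat \<Rightarrow> 'a \<Rightarrow> 'b::{real_normed_field, euclidean_space}) \<Rightarrow> ('a \<Rightarrow> 'b) \<Rightarrow> bool" where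
  "Lp_tendsto M p F f \<longleftrightarrow>
     (\<forall>k. Lp_mem M p (F k)) \<and> Lp_mem M p f \<and>
     (\<lambda>k. Lp_norm M p (\<lambda>x. F k x - f x)) \<longlonglongrightarrow> 0"

definition symmetric_stable_process :: "'a measure \<Rightarrow> (real \<Rightarrow> 'a \<Rightarrow> real) \<Rightarrow> real \<Rightarrow> bool" where
  "symmetric_stable_process M X \<gamma> \<longleftrightarrow>
     prob_space M \<and>
     (\<forall>t. X t \<in> borel_measurable M) \<and>
     (\<forall>m (t :: nat \<Rightarrow> real). strict_mono_on {..m} t \<longrightarrow>
        prob_space.indep_vars M (\<lambda>_. borel) (\<lambda>j \<omega>. X (t (Suc j)) \<omega> - X (t j) \<omega>) {..<m}) \<and>
     (\<exists>c>0. \<forall>s t u. (CLINT \<omega>|M. iexp (u * (X t \<omega> - X s \<omega>)))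
                       = complex_of_real (exp (- c * \<bar>t - s\<bar> * \<bar>u\<bar> powr \<gamma>)))"

(* phi is a step function on [a,b] and S is its elementary stochastic integral. *)
definition step_integral ::
    "(real \<Rightarrow> 'a \<Rightarrow> real) \<Rightarrow> real \<Rightarrow> real \<Rightarrow> (real \<Rightarrow> 'b::{real_normed_field, euclidean_space})
       \<Rightarrow> ('a \<Rightarrow> 'b) \<Rightarrow> bool" where
  "step_integral X a b \<phi> S \<longleftrightarrow>
     (\<exists>m (t :: nat \<Rightarrow> real) c.
        strict_mono_on {..m} t \<and> t ` {..m} \<subseteq> {a..b} \<and>
        \<phi> = (\<lambda>x. \<Sum>j<m. indicator {t j<..t (Suc j)} x *\<^sub>R c j) \<and>
        S = (\<lambda>\<omega>. \<Sum>j<m. (X (t (Suc j)) \<omega> - X (t j) \<omega>) *\<^sub>R c j))"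

(* The integral is determined up to almost sure equality, hence a relation. The limit has to be
   independent of the approximating sequence, and some approximating sequence has to exist.
   On a bounded interval L^p is contained in L^gamma for p >= gamma, so L^gamma is the
   largest class of integrands. *)
definition has_stoch_integral ::
    "'a measure \<Rightarrow> (real \<Rightarrow> 'a \<Rightarrow> real) \<Rightarrow> real \<Rightarrow> real \<Rightarrow> real
       \<Rightarrow> (real \<Rightarrow> 'b::{real_normed_field, euclidean_space}) \<Rightarrow> ('a \<Rightarrow> 'b) \<Rightarrow> bool" where
  "has_stoch_integral M X \<gamma> a b f Y \<longleftrightarrow>
     (\<exists>\<phi> S. (\<forall>k. step_integral X a b (\<phi> k) (S k)) \<and> Lp_tendsto (lebesgue_on {a..b}) \<gamma> \<phi> f) \<and>
     (\<forall>\<phi> S. (\<forall>k. step_integral X a b (\<phi> k) (S k)) \<longrightarrow>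
        Lp_tendsto (lebesgue_on {a..b}) \<gamma> \<phi> f \<longrightarrow> Lp_tendsto M 1 S Y)"

definition has_stoch_integral_line ::
    "'a measure \<Rightarrow> (real \<Rightarrow> 'a \<Rightarrow> real) \<Rightarrow> real
       \<Rightarrow> (real \<Rightarrow> 'b::{real_normed_field, euclidean_space}) \<Rightarrow> ('a \<Rightarrow> 'b) \<Rightarrow> bool" where
  "has_stoch_integral_line M X \<gamma> f Z \<longleftrightarrow>
     (\<forall>n::nat. \<exists>Y. has_stoch_integral M X \<gamma> (- real n) (real n) f Y) \<and>
     (\<forall>Y. (\<forall>n. has_stoch_integral M X \<gamma> (- real n) (real n) f (Y n)) \<longrightarrow> Lp_tendsto M 1 Y Z)"

end

theory Submission
  imports Defs
begin

text \<open>
The integral of a step function \<open>\<phi>\<close> is a linear combination of independent stable increments. Its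
coordinates are therefore symmetric stable variables, with scale parameter at most a constant times
the \<open>L\<^sup>\<gamma>\<close> norm of \<open>\<phi>\<close>. As \<open>1 < \<gamma>\<close>, such variables have a first absolute moment, and it is
proportional to the scale parameter. Hence the elementary integral is a bounded operator from step
functions in \<open>L\<^sup>\<gamma>\<close> to \<open>L\<^sup>1(\<Omega>)\<close>, with a bound that does not depend on the interval that carries the step
function (\<open>step_integral_norm_bound\<close>).

Differences of step functions are step functions on a common refinement (\<open>step_integral_diff\<close>), and
\<open>L\<^sup>1(\<Omega>)\<close> is complete. So for each \<open>f\<close> there is one random variable to which the integrals of all
sequences of step functions converge that tend to \<open>f\<close> in \<open>L\<^sup>\<gamma>\<close> of the line, even if the intervals
grow along the sequence (\<open>step_integrals_converge\<close>). For \<open>f\<close> restricted to \<open>[-n, n]\<close> this variable is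
the integral over \<open>[-n, n]\<close>, since step functions are dense (\<open>step_functions_dense\<close>). For \<open>f\<close> itself
it is the integral over the line: by dominated convergence the restrictions of \<open>f\<close> to \<open>[-n, n]\<close> tend to
\<open>f\<close> in \<open>L\<^sup>\<gamma>\<close>, so step functions chosen close enough to these restrictions also tend to \<open>f\<close>, and
their integrals are close to the integrals over \<open>[-n, n]\<close>.
\<close>

section \<open>Absolute moments of stable variables\<close>

text \<open>By scaling, the integral is a constant times \<open>\<bar>x\<bar>\<close>. This turns a first absolute moment into an
integral over the real part of the characteristic function. A lower bound for the constant is enough,
and it comes from the frequencies where the cosine is not positive.\<close>

lemma abs_le_nn_integral_cos:
  fixes x :: real
  shows "ennreal \<bar>x\<bar> \<le> ennreal (2 * pi) * (\<integral>\<^sup>+u. ennreal ((1 - cos (u * x)) / u\<^sup>2) * indicator {0<..} u \<partial>lborel)"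
proof (cases "x = 0")
  case False
  define y where "y = \<bar>x\<bar>"
  have y: "y > 0" using False by (simp add: y_def)
  let ?I = "{pi / (2 * y) .. pi / y}"
  have le: "pi / (2 * y) \<le> pi / y" using y by (simp add: field_simps)
  \<comment> \<open>On this interval u y is between pi/2 and pi, so the cosine is at most 0; the length of the
     interval times the lower bound for the kernel is y/(2 pi).\<close>
  have pointwise: "ennreal (y\<^sup>2 / pi\<^sup>2) * indicator ?I u
      \<le> ennreal ((1 - cos (u * x)) / u\<^sup>2) * indicator {0<..} u" for u :: real
  proof (cases "u \<in> ?I")
    case True
    then have u: "pi / (2 * y) \<le> u" "u \<le> pi / y" by auto
    have u0: "u > 0" using u(1) y pi_gt_zero by (smt (verit) divide_pos_pos)
    have "pi / 2 \<le> u * y" "u * y \<le> pi"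
      using u y by (simp_all add: field_simps)
    then have "cos (u * y) \<le> 0"
      using cos_monotone_0_pi_le[of "pi/2" "u * y"] by simp
    moreover have "cos (u * x) = cos (u * y)"
      by (auto simp: y_def abs_if)
    ultimately have "cos (u * x) \<le> 0" by simp
    moreover have "y\<^sup>2 / pi\<^sup>2 \<le> 1 / u\<^sup>2"
      using power_mono[OF \<open>u * y \<le> pi\<close>, of 2] u0 y
      by (simp add: field_simps power_mult_distrib)
    ultimately have "y\<^sup>2 / pi\<^sup>2 \<le> (1 - cos (u * x)) / u\<^sup>2"
      by (smt (verit) divide_right_mono zero_le_power2)
    then show ?thesis using True u0 by (simp add: ennreal_leI)
  qed auto
  have "ennreal \<bar>x\<bar> = ennreal (2 * pi) * (ennreal (y\<^sup>2 / pi\<^sup>2) * ennreal (pi / (2 * y)))"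
    using y by (subst ennreal_mult[symmetric]; simp?)+ (simp add: y_def field_simps power2_eq_square)
  also have "ennreal (y\<^sup>2 / pi\<^sup>2) * ennreal (pi / (2 * y)) = (\<integral>\<^sup>+u. ennreal (y\<^sup>2 / pi\<^sup>2) * indicator ?I u \<partial>lborel)"
    using le y by (simp add: nn_integral_cmult_indicator field_simps)
  also have "\<dots> \<le> (\<integral>\<^sup>+u. ennreal ((1 - cos (u * x)) / u\<^sup>2) * indicator {0<..} u \<partial>lborel)"
    by (intro nn_integral_mono pointwise)
  finally show ?thesis by (simp add: mult_left_mono)
qed simp

text \<open>The integrand is at most \<open>\<sigma> * u powr (\<gamma> - 2)\<close> near 0, which is integrable because \<open>1 < \<gamma>\<close>, and at
most \<open>u powr -2\<close> at infinity.\<close>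

lemma nn_integral_stable_exponent_le:
  fixes \<sigma> \<gamma> :: real
  assumes "1 < \<gamma>" and "0 \<le> \<sigma>"
  shows "(\<integral>\<^sup>+u. ennreal ((1 - exp (- \<sigma> * \<bar>u\<bar> powr \<gamma>)) / u\<^sup>2) * indicator {0<..} u \<partial>lborel)
    \<le> ennreal (\<gamma> / (\<gamma> - 1) * \<sigma> powr (1 / \<gamma>))"
proof (cases "\<sigma> = 0")
  case False
  with assms have s: "\<sigma> > 0" by simp
  \<comment> \<open>The bounds \<open>1 - exp (- v) \<le> v\<close> and \<open>1 - exp (- v) \<le> 1\<close> balance where v is of order 1, that is,
     near this cut.\<close>
  define a where "a = \<sigma> powr (- 1 / \<gamma>)"
  have a: "a > 0" using s by (simp add: a_def)
  have pointwise: "ennreal ((1 - exp (- \<sigma> * \<bar>u\<bar> powr \<gamma>)) / u\<^sup>2) * indicator {0<..} u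
      \<le> ennreal (\<sigma> * u powr (\<gamma> - 2)) * indicator {0..a} u + ennreal (u powr -2) * indicator {a..} u"
    for u :: real
  proof (cases "u > 0")
    case True
    have p: "u powr \<gamma> / u\<^sup>2 = u powr (\<gamma> - 2)" "1 / u\<^sup>2 = u powr -2"
      using True powr_numeral[of u Num.One] by (simp_all add: powr_diff powr_minus_divide)
    have "1 - exp (- \<sigma> * u powr \<gamma>) \<le> \<sigma> * u powr \<gamma>"
      using exp_ge_add_one_self[of "- \<sigma> * u powr \<gamma>"] by simp
    from divide_right_mono[OF this, of "u\<^sup>2"]
    have 1: "(1 - exp (- \<sigma> * u powr \<gamma>)) / u\<^sup>2 \<le> \<sigma> * u powr (\<gamma> - 2)"
      by (simp add: p(1)[symmetric])
    have "(1 - exp (- \<sigma> * u powr \<gamma>)) / u\<^sup>2 \<le> 1 / u\<^sup>2"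
      by (intro divide_right_mono) auto
    then have 2: "(1 - exp (- \<sigma> * u powr \<gamma>)) / u\<^sup>2 \<le> u powr -2"
      by (simp only: p(2))
    show ?thesis
    proof (cases "u \<le> a")
      case True
      then show ?thesis using 1 \<open>u > 0\<close> by (auto intro!: add_increasing2 ennreal_leI)
    next
      case False
      then show ?thesis using 2 \<open>u > 0\<close> by (auto intro!: add_increasing ennreal_leI)
    qed
  qed auto
  have near: "(\<integral>\<^sup>+u. ennreal (\<sigma> * u powr (\<gamma> - 2)) * indicator {0..a} u \<partial>lborel)
      = ennreal (\<sigma> * (a powr (\<gamma> - 2 + 1) / (\<gamma> - 2 + 1)))"
    using assms a
    by (intro nn_integral_has_integral_lebesgue' has_integral_mult_right has_integral_powr_from_0) auto
  have far: "(\<integral>\<^sup>+u. ennreal (u powr -2) * indicator {a..} u \<partial>lborel)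
      = ennreal (- (a powr (-2 + 1)) / (-2 + 1))"
    using a by (intro nn_integral_has_integral_lebesgue' has_integral_powr_to_inf) auto
  have s1: "\<sigma> * a powr (\<gamma> - 2 + 1) = \<sigma> powr (1 / \<gamma>)"
  proof -
    have "\<sigma> * a powr (\<gamma> - 2 + 1) = \<sigma> powr (1 + (- 1 / \<gamma>) * (\<gamma> - 2 + 1))"
      unfolding a_def powr_powr using s by (intro powr_mult_base) simp_all
    also have "1 + (- 1 / \<gamma>) * (\<gamma> - 2 + 1) = 1 / \<gamma>" using assms by (simp add: field_simps)
    finally show ?thesis .
  qed
  have s2: "a powr (-2 + 1) = \<sigma> powr (1 / \<gamma>)" unfolding a_def powr_powr by simp
  have "(\<integral>\<^sup>+u. ennreal ((1 - exp (- \<sigma> * \<bar>u\<bar> powr \<gamma>)) / u\<^sup>2) * indicator {0<..} u \<partial>lborel)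
    \<le> (\<integral>\<^sup>+u. ennreal (\<sigma> * u powr (\<gamma> - 2)) * indicator {0..a} u + ennreal (u powr -2) * indicator {a..} u \<partial>lborel)"
    by (intro nn_integral_mono pointwise)
  also have "\<dots> = ennreal (\<sigma> * (a powr (\<gamma> - 2 + 1) / (\<gamma> - 2 + 1))) + ennreal (- (a powr (-2 + 1)) / (-2 + 1))"
    by (subst nn_integral_add) (simp_all only: near far, auto)
  also have "\<dots> = ennreal (\<sigma> powr (1 / \<gamma>) / (\<gamma> - 1) + \<sigma> powr (1 / \<gamma>))"
    using assms s1 s2 by (subst ennreal_plus[symmetric]) auto
  also have "\<sigma> powr (1 / \<gamma>) / (\<gamma> - 1) + \<sigma> powr (1 / \<gamma>) = \<gamma> / (\<gamma> - 1) * \<sigma> powr (1 / \<gamma>)"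
    using assms by (simp add: field_simps)
  finally show ?thesis .
qed simp

text \<open>A symmetric stable variable of index above 1 has a first moment of the order of its scale parameter
\<open>\<sigma> powr (1 / \<gamma>)\<close>: Tonelli's theorem exchanges the expectation with the frequency integral.\<close>

lemma (in prob_space) nn_integral_abs_stable_le:
  fixes Y :: "'a \<Rightarrow> real" and \<sigma> \<gamma> :: real
  assumes [measurable]: "Y \<in> borel_measurable M" and "1 < \<gamma>" and "0 \<le> \<sigma>"
    and cf: "\<And>u. char (distr M borel Y) u = complex_of_real (exp (- \<sigma> * \<bar>u\<bar> powr \<gamma>))"
  shows "(\<integral>\<^sup>+\<omega>. ennreal \<bar>Y \<omega>\<bar> \<partial>M) \<le> ennreal (2 * pi * (\<gamma> / (\<gamma> - 1)) * \<sigma> powr (1 / \<gamma>))"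
proof -
  interpret pair_sigma_finite lborel M
    by (intro pair_sigma_finite.intro sigma_finite_lborel) unfold_locales
  have cosint: "integrable M (\<lambda>\<omega>. cos (u * Y \<omega>))" for u
    by (intro integrable_const_bound[of _ 1]) auto
  have "expectation (\<lambda>\<omega>. cos (u * Y \<omega>)) = exp (- \<sigma> * \<bar>u\<bar> powr \<gamma>)" for u
  proof -
    have "Re (CLINT \<omega>|M. iexp (u * Y \<omega>)) = expectation (\<lambda>\<omega>. Re (iexp (u * Y \<omega>)))"
      using integrable_iexp[of "\<lambda>\<omega>. of_real (u * Y \<omega>)"] by (intro integral_Re[symmetric]) auto
    moreover have "char (distr M borel Y) u = (CLINT \<omega>|M. iexp (u * Y \<omega>))"
      by (simp add: char_def integral_distr)
    moreover have "Re (char (distr M borel Y) u) = exp (- \<sigma> * \<bar>u\<bar> powr \<gamma>)"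
      by (simp only: cf Re_complex_of_real)
    ultimately show ?thesis by (simp add: Re_exp)
  qed
  then have inner: "(\<integral>\<^sup>+\<omega>. ennreal ((1 - cos (u * Y \<omega>)) / u\<^sup>2) \<partial>M)
      = ennreal ((1 - exp (- \<sigma> * \<bar>u\<bar> powr \<gamma>)) / u\<^sup>2)" for u
    using cosint[of u]
    by (subst nn_integral_eq_integral) (auto simp: prob_space)
  have "(\<integral>\<^sup>+\<omega>. ennreal \<bar>Y \<omega>\<bar> \<partial>M) \<le> (\<integral>\<^sup>+\<omega>. ennreal (2 * pi) *
      (\<integral>\<^sup>+u. ennreal ((1 - cos (u * Y \<omega>)) / u\<^sup>2) * indicator {0<..} u \<partial>lborel) \<partial>M)"
    by (intro nn_integral_mono abs_le_nn_integral_cos)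
  also have "\<dots> = ennreal (2 * pi) *
      (\<integral>\<^sup>+\<omega>. (\<integral>\<^sup>+u. ennreal ((1 - cos (u * Y \<omega>)) / u\<^sup>2) * indicator {0<..} u \<partial>lborel) \<partial>M)"
    by (intro nn_integral_cmult) measurable
  also have "\<dots> = ennreal (2 * pi) *
      (\<integral>\<^sup>+u. (\<integral>\<^sup>+\<omega>. ennreal ((1 - cos (u * Y \<omega>)) / u\<^sup>2) * indicator {0<..} u \<partial>M) \<partial>lborel)"
    by (subst Fubini') auto
  also have "\<dots> = ennreal (2 * pi) *
      (\<integral>\<^sup>+u. ennreal ((1 - exp (- \<sigma> * \<bar>u\<bar> powr \<gamma>)) / u\<^sup>2) * indicator {0<..} u \<partial>lborel)"
    by (simp add: nn_integral_multc inner)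
  also have "\<dots> \<le> ennreal (2 * pi) * ennreal (\<gamma> / (\<gamma> - 1) * \<sigma> powr (1 / \<gamma>))"
    using nn_integral_stable_exponent_le[OF assms(2,3)] by (intro mult_left_mono) auto
  also have "\<dots> = ennreal (2 * pi * (\<gamma> / (\<gamma> - 1)) * \<sigma> powr (1 / \<gamma>))"
    using assms by (subst ennreal_mult[symmetric]) (auto simp: mult.assoc)
  finally show ?thesis .
qed

section \<open>Step functions and common refinements\<close>

lemma step_function_eq:
  fixes t :: "nat \<Rightarrow> real" and c :: "nat \<Rightarrow> 'b::real_vector"
  assumes t: "strict_mono_on {..m} t" and j: "j < m" "x \<in> {t j<..t (Suc j)}"
  shows "(\<Sum>i<m. indicator {t i<..t (Suc i)} x *\<^sub>R c i) = c j"
proof -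
  have mono: "t k \<le> t l" if "k \<le> l" "l \<le> m" for k l
    using strict_mono_on_leD[OF t, of k l] that by auto
  have ind: "indicator {t i<..t (Suc i)} x = (if i = j then 1 else 0 :: real)" if "i < m" for i
  proof (cases i j rule: linorder_cases)
    case less
    then show ?thesis using mono[of "Suc i" j] j by (auto simp: indicator_def)
  next
    case greater
    then show ?thesis using mono[of "Suc j" i] j that by (auto simp: indicator_def)
  qed (use j in auto)
  have "(\<Sum>i<m. indicator {t i<..t (Suc i)} x *\<^sub>R c i) = (\<Sum>i<m. if i = j then c i else 0)"
    by (intro sum.cong) (auto simp: ind)
  then show ?thesis using j(1) by (simp only: sum.delta finite_lessThan lessThan_iff if_True)
qed

text \<open>At most one summand is nonzero at each point, so any map that fixes 0 acts on the coefficients.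
This serves for the \<open>p\<close>-th power of the norm and for the removal of large values.\<close>

lemma step_function_compose:
  fixes t :: "nat \<Rightarrow> real" and F :: "'b::real_vector \<Rightarrow> 'c::real_vector"
  assumes t: "strict_mono_on {..m} t" and F0: "F 0 = 0"
  shows "F (\<Sum>j<m. indicator {t j<..t (Suc j)} x *\<^sub>R c j)
    = (\<Sum>j<m. indicator {t j<..t (Suc j)} x *\<^sub>R F (c j))"
proof (cases "\<exists>j<m. x \<in> {t j<..t (Suc j)}")
  case True
  then obtain j where j: "j < m" "x \<in> {t j<..t (Suc j)}" by blast
  show ?thesis by (simp only: step_function_eq[OF t j])
next
  case False
  then have "indicator {t j<..t (Suc j)} x = (0 :: real)" if "j < m" for j
    using that by (auto simp: indicator_def)
  then show ?thesis using F0 by simp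
qed

lemma step_function_eq_0:
  fixes t :: "nat \<Rightarrow> real" and c :: "nat \<Rightarrow> 'b::real_vector"
  assumes t: "strict_mono_on {..m} t" "t ` {..m} \<subseteq> {a..b}" and "x \<notin> {a<..b}"
  shows "(\<Sum>j<m. indicator {t j<..t (Suc j)} x *\<^sub>R c j) = 0"
proof (intro sum.neutral ballI)
  fix j assume "j \<in> {..<m}"
  then have "t j \<in> t ` {..m}" "t (Suc j) \<in> t ` {..m}" by auto
  then have "a \<le> t j" "t (Suc j) \<le> b" using t(2) by auto
  then show "indicator {t j<..t (Suc j)} x *\<^sub>R c j = 0"
    using assms(3) by (auto simp: indicator_def)
qed

lemma has_bochner_integral_step_function:
  fixes t :: "nat \<Rightarrow> real" and c :: "nat \<Rightarrow> 'b::{banach, second_countable_topology}"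
  assumes t: "strict_mono_on {..m} t"
  shows "has_bochner_integral lebesgue (\<lambda>x. \<Sum>j<m. indicator {t j<..t (Suc j)} x *\<^sub>R c j)
    (\<Sum>j<m. (t (Suc j) - t j) *\<^sub>R c j)"
proof (intro has_bochner_integral_sum)
  fix j assume "j \<in> {..<m}"
  then have "t j \<le> t (Suc j)"
    using strict_mono_on_leD[OF t, of j "Suc j"] by auto
  then have "has_bochner_integral lebesgue (indicator {t j<..t (Suc j)} :: real \<Rightarrow> real) (t (Suc j) - t j)"
    using has_bochner_integral_real_indicator[of "{t j<..t (Suc j)}" lebesgue]
    by (simp add: measure_def)
  then show "has_bochner_integral lebesgue (\<lambda>x. indicator {t j<..t (Suc j)} x *\<^sub>R c j) ((t (Suc j) - t j) *\<^sub>R c j)"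
    by (intro has_bochner_integral_scaleR_left) simp
qed

lemma step_integral_Lp_mem:
  assumes "step_integral X a b \<phi> S" and "0 < p"
  shows "Lp_mem lebesgue p \<phi>"
proof -
  obtain m t c where t: "strict_mono_on {..m} t"
    and \<phi>: "\<phi> = (\<lambda>x. \<Sum>j<m. indicator {t j<..t (Suc j)} x *\<^sub>R c j)"
    using assms(1) unfolding step_integral_def by blast
  have "norm (\<phi> x) powr p = (\<Sum>j<m. indicator {t j<..t (Suc j)} x *\<^sub>R (norm (c j) powr p))" for x
    unfolding \<phi> using t by (rule step_function_compose) simp
  moreover have "\<phi> \<in> borel_measurable lebesgue"
    unfolding \<phi> by (rule borel_measurable_has_bochner_integral[OF has_bochner_integral_step_function[OF t]])
  ultimately show ?thesis
    unfolding Lp_mem_def using has_bochner_integral_step_function[OF t, of "\<lambda>j. norm (c j) powr p"]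
    by (simp only: has_bochner_integral_iff conj_absorb simp_thms)
qed

lemma finite_set_strict_mono_enumeration:
  fixes P :: "'a::linorder set"
  assumes "finite P" "P \<noteq> {}"
  obtains m :: nat and p where "strict_mono_on {..m} p" and "p ` {..m} = P"
proof
  let ?l = "sorted_list_of_set P"
  have "card P = Suc (card P - 1)" using assms by (simp add: card_gt_0_iff)
  then have len: "{..card P - 1} = {..<length ?l}"
    by (metis lessThan_Suc_atMost length_sorted_list_of_set)
  show "strict_mono_on {..card P - 1} ((!) ?l)"
    unfolding len by (intro strict_mono_onI) (simp add: sorted_wrt_nth_less)
  show "(!) ?l ` {..card P - 1} = P"
    unfolding len using set_sorted_list_of_set[OF assms(1)] by (auto simp: set_conv_nth)
qed

text \<open>The refinement is stated for the increments of an arbitrary function \<open>g\<close>. With \<open>g\<close> a path of the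
process it applies to the integral of a step function, and with \<open>g\<close> the indicator of a half-line it
applies to the step function itself.\<close>

lemma increments_refine:
  fixes t p :: "nat \<Rightarrow> real" and c :: "nat \<Rightarrow> 'b::real_vector"
  assumes t: "strict_mono_on {..n} t" and p: "strict_mono_on {..m} p" and sub: "t ` {..n} \<subseteq> p ` {..m}"
  obtains d where "\<And>g :: real \<Rightarrow> real. (\<Sum>l<n. (g (t (Suc l)) - g (t l)) *\<^sub>R c l)
    = (\<Sum>j<m. (g (p (Suc j)) - g (p j)) *\<^sub>R d j)"
proof -
  have "\<forall>l\<in>{..n}. \<exists>i. i \<le> m \<and> t l = p i" using sub by fastforce
  then obtain i where i: "\<And>l. l \<le> n \<Longrightarrow> i l \<le> m \<and> t l = p (i l)"
    by (metis atMost_iff)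
  have mono: "i l \<le> i (Suc l)" if "l < n" for l
  proof (rule ccontr)
    assume "\<not> ?thesis"
    then have "p (i (Suc l)) < p (i l)" using i[of l] i[of "Suc l"] that
      by (intro strict_mono_onD[OF p]) auto
    moreover have "t l < t (Suc l)" using that by (intro strict_mono_onD[OF t]) auto
    ultimately show False using i[of l] i[of "Suc l"] that by simp
  qed
  \<comment> \<open>The l-th coarse increment is the telescoping sum of the fine increments between its end points;
     d j collects the coefficients of all coarse increments that contain the j-th fine one.\<close>
  define d where "d j = (\<Sum>l<n. (if i l \<le> j \<and> j < i (Suc l) then c l else 0))" for j
  have "(\<Sum>l<n. (g (t (Suc l)) - g (t l)) *\<^sub>R c l) = (\<Sum>j<m. (g (p (Suc j)) - g (p j)) *\<^sub>R d j)"
    for g :: "real \<Rightarrow> real"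
  proof -
    have "(g (t (Suc l)) - g (t l)) *\<^sub>R c l
        = (\<Sum>j<m. (g (p (Suc j)) - g (p j)) *\<^sub>R (if i l \<le> j \<and> j < i (Suc l) then c l else 0))"
      if l: "l < n" for l
    proof -
      have "g (t (Suc l)) - g (t l) = (\<Sum>j=i l..<i (Suc l). g (p (Suc j)) - g (p j))"
        using sum_Suc_diff'[OF mono[OF l], of "\<lambda>j. g (p j)"] i[of l] i[of "Suc l"] l by simp
      also have "\<dots> *\<^sub>R c l = (\<Sum>j=i l..<i (Suc l). (g (p (Suc j)) - g (p j)) *\<^sub>R c l)"
        by (rule scaleR_sum_left)
      also have "\<dots> = (\<Sum>j<m. if j \<in> {i l..<i (Suc l)} then (g (p (Suc j)) - g (p j)) *\<^sub>R c l else 0)"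
        using i[of "Suc l"] l by (subst sum.inter_restrict[symmetric]) (auto intro!: sum.cong)
      also have "\<dots> = (\<Sum>j<m. (g (p (Suc j)) - g (p j)) *\<^sub>R (if i l \<le> j \<and> j < i (Suc l) then c l else 0))"
        by (intro sum.cong) auto
      finally show ?thesis .
    qed
    then have "(\<Sum>l<n. (g (t (Suc l)) - g (t l)) *\<^sub>R c l)
        = (\<Sum>l<n. \<Sum>j<m. (g (p (Suc j)) - g (p j)) *\<^sub>R (if i l \<le> j \<and> j < i (Suc l) then c l else 0))"
      by (intro sum.cong) auto
    also have "\<dots> = (\<Sum>j<m. \<Sum>l<n. (g (p (Suc j)) - g (p j)) *\<^sub>R (if i l \<le> j \<and> j < i (Suc l) then c l else 0))"
      by (rule sum.swap)
    finally show ?thesis by (simp add: d_def scaleR_sum_right)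
  qed
  then show thesis by (rule that)
qed

lemma step_function_as_increments:
  fixes t :: "nat \<Rightarrow> real"
  assumes "strict_mono_on {..m} t"
  shows "(\<Sum>j<m. indicator {t j<..t (Suc j)} x *\<^sub>R c j)
    = (\<Sum>j<m. (indicator {x..} (t (Suc j)) - indicator {x..} (t j)) *\<^sub>R c j)"
proof (intro sum.cong refl)
  fix j assume "j \<in> {..<m}"
  then have "t j < t (Suc j)" by (intro strict_mono_onD[OF assms]) auto
  then show "indicator {t j<..t (Suc j)} x *\<^sub>R c j
    = (indicator {x..} (t (Suc j)) - indicator {x..} (t j)) *\<^sub>R c j"
    by (auto simp: indicator_def)
qed

text \<open>Both step functions and both integrals are written with the same increments over the union of the
two partitions.\<close>

lemma step_integral_diff:
  assumes "step_integral X a b \<phi> S" and "step_integral X a' b' \<psi> T"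
  shows "step_integral X (min a a') (max b b') (\<lambda>x. \<phi> x - \<psi> x) (\<lambda>\<omega>. S \<omega> - T \<omega>)"
proof -
  obtain m t c where t: "strict_mono_on {..m} t" "t ` {..m} \<subseteq> {a..b}"
    and \<phi>: "\<phi> = (\<lambda>x. \<Sum>j<m. indicator {t j<..t (Suc j)} x *\<^sub>R c j)"
    and S: "S = (\<lambda>\<omega>. \<Sum>j<m. (X (t (Suc j)) \<omega> - X (t j) \<omega>) *\<^sub>R c j)"
    using assms(1) unfolding step_integral_def by blast
  obtain n s d where s: "strict_mono_on {..n} s" "s ` {..n} \<subseteq> {a'..b'}"
    and \<psi>: "\<psi> = (\<lambda>x. \<Sum>j<n. indicator {s j<..s (Suc j)} x *\<^sub>R d j)"
    and T: "T = (\<lambda>\<omega>. \<Sum>j<n. (X (s (Suc j)) \<omega> - X (s j) \<omega>) *\<^sub>R d j)"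
    using assms(2) unfolding step_integral_def by blast
  obtain k :: nat and p :: "nat \<Rightarrow> real" where p: "strict_mono_on {..k} p" and im: "p ` {..k} = t ` {..m} \<union> s ` {..n}"
    by (rule finite_set_strict_mono_enumeration[of "t ` {..m} \<union> s ` {..n}"]) auto
  from increments_refine[OF t(1) p, of c] im obtain c' where
    c': "\<And>g :: real \<Rightarrow> real. (\<Sum>l<m. (g (t (Suc l)) - g (t l)) *\<^sub>R c l)
      = (\<Sum>j<k. (g (p (Suc j)) - g (p j)) *\<^sub>R c' j)" by blast
  from increments_refine[OF s(1) p, of d] im obtain d' where
    d': "\<And>g :: real \<Rightarrow> real. (\<Sum>l<n. (g (s (Suc l)) - g (s l)) *\<^sub>R d l)
      = (\<Sum>j<k. (g (p (Suc j)) - g (p j)) *\<^sub>R d' j)" by blast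
  show ?thesis
    unfolding step_integral_def
  proof (intro exI[of _ k] exI[of _ p] exI[of _ "\<lambda>j. c' j - d' j"] conjI p)
    show "p ` {..k} \<subseteq> {min a a'..max b b'}"
      unfolding im using t(2) s(2) by fastforce
    show "(\<lambda>x. \<phi> x - \<psi> x) = (\<lambda>x. \<Sum>j<k. indicator {p j<..p (Suc j)} x *\<^sub>R (c' j - d' j))"
      unfolding \<phi> \<psi> step_function_as_increments[OF t(1)] step_function_as_increments[OF s(1)]
        step_function_as_increments[OF p] c' d'
      by (simp only: scaleR_diff_right sum_subtractf)
    show "(\<lambda>\<omega>. S \<omega> - T \<omega>) = (\<lambda>\<omega>. \<Sum>j<k. (X (p (Suc j)) \<omega> - X (p j) \<omega>) *\<^sub>R (c' j - d' j))"
      unfolding S T using c'[of "\<lambda>r. X r _"] d'[of "\<lambda>r. X r _"]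
      by (simp only: scaleR_diff_right sum_subtractf)
  qed
qed

section \<open>The norm bound for integrals of step functions\<close>

text \<open>By independence the exponents add, so the scale parameter to the power \<open>\<gamma>\<close> is \<open>c\<close> times the
\<open>\<gamma>\<close>-th power of the norm of the step function with values \<open>k j\<close>.\<close>

lemma char_stable_combination:
  fixes t k :: "nat \<Rightarrow> real"
  assumes "prob_space M" and [measurable]: "\<And>s. X s \<in> borel_measurable M"
    and indep: "prob_space.indep_vars M (\<lambda>_. borel) (\<lambda>j \<omega>. X (t (Suc j)) \<omega> - X (t j) \<omega>) {..<m}"
    and cf: "\<And>s s' u. (CLINT \<omega>|M. iexp (u * (X s' \<omega> - X s \<omega>)))
        = complex_of_real (exp (- c * \<bar>s' - s\<bar> * \<bar>u\<bar> powr \<gamma>))"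
    and t: "strict_mono_on {..m} t"
  shows "char (distr M borel (\<lambda>\<omega>. \<Sum>j<m. (X (t (Suc j)) \<omega> - X (t j) \<omega>) * k j)) u
    = complex_of_real (exp (- (c * (\<Sum>j<m. (t (Suc j) - t j) * \<bar>k j\<bar> powr \<gamma>)) * \<bar>u\<bar> powr \<gamma>))"
proof -
  interpret prob_space M by fact
  have le: "t j \<le> t (Suc j)" if "j < m" for j
    using strict_mono_on_leD[OF t, of j "Suc j"] that by auto
  have "indep_vars (\<lambda>_. borel) (\<lambda>j \<omega>. (X (t (Suc j)) \<omega> - X (t j) \<omega>) * k j) {..<m}"
    by (rule indep_vars_compose2[OF indep, where Y="\<lambda>j x. x * k j"]) simp
  then have "char (distr M borel (\<lambda>\<omega>. \<Sum>j<m. (X (t (Suc j)) \<omega> - X (t j) \<omega>) * k j)) u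
    = (\<Prod>j<m. char (distr M borel (\<lambda>\<omega>. (X (t (Suc j)) \<omega> - X (t j) \<omega>) * k j)) u)"
    by (rule char_distr_sum)
  also have "\<dots> = (\<Prod>j<m. complex_of_real (exp (- c * ((t (Suc j) - t j) * \<bar>k j\<bar> powr \<gamma>) * \<bar>u\<bar> powr \<gamma>)))"
  proof (intro prod.cong refl)
    fix j assume "j \<in> {..<m}"
    have "char (distr M borel (\<lambda>\<omega>. (X (t (Suc j)) \<omega> - X (t j) \<omega>) * k j)) u
      = (CLINT \<omega>|M. iexp (u * ((X (t (Suc j)) \<omega> - X (t j) \<omega>) * k j)))"
      unfolding char_def by (subst integral_distr) auto
    also have "\<dots> = (CLINT \<omega>|M. iexp ((u * k j) * (X (t (Suc j)) \<omega> - X (t j) \<omega>)))"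
      by (simp add: mult_ac)
    also have "\<dots> = complex_of_real (exp (- c * \<bar>t (Suc j) - t j\<bar> * \<bar>u * k j\<bar> powr \<gamma>))"
      by (rule cf)
    also have "- c * \<bar>t (Suc j) - t j\<bar> * \<bar>u * k j\<bar> powr \<gamma> = - c * ((t (Suc j) - t j) * \<bar>k j\<bar> powr \<gamma>) * \<bar>u\<bar> powr \<gamma>"
      using le[of j] \<open>j \<in> {..<m}\<close> by (simp add: abs_mult powr_mult)
    finally show "char (distr M borel (\<lambda>\<omega>. (X (t (Suc j)) \<omega> - X (t j) \<omega>) * k j)) u
      = complex_of_real (exp (- c * ((t (Suc j) - t j) * \<bar>k j\<bar> powr \<gamma>) * \<bar>u\<bar> powr \<gamma>))" .
  qed
  also have "\<dots> = complex_of_real (exp (\<Sum>j<m. - c * ((t (Suc j) - t j) * \<bar>k j\<bar> powr \<gamma>) * \<bar>u\<bar> powr \<gamma>))"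
    by (simp add: exp_sum)
  also have "(\<Sum>j<m. - c * ((t (Suc j) - t j) * \<bar>k j\<bar> powr \<gamma>) * \<bar>u\<bar> powr \<gamma>)
    = - (c * (\<Sum>j<m. (t (Suc j) - t j) * \<bar>k j\<bar> powr \<gamma>)) * \<bar>u\<bar> powr \<gamma>"
    by (simp add: sum_distrib_left sum_distrib_right sum_negf)
  finally show ?thesis .
qed

text \<open>The estimate behind all limits: the elementary integral is bounded from step functions with the
\<open>L\<^sup>\<gamma>\<close> norm to \<open>L\<^sup>1\<close>, with a constant that does not depend on the interval. Vector values are treated
coordinate by coordinate.\<close>

lemma step_integral_norm_bound:
  fixes X :: "real \<Rightarrow> 'a \<Rightarrow> real"
  assumes "symmetric_stable_process M X \<gamma>" and "1 < \<gamma>"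
  shows "\<exists>C\<ge>0. \<forall>a b \<phi> (S :: 'a \<Rightarrow> 'b::{real_normed_field, euclidean_space}).
    step_integral X a b \<phi> S \<longrightarrow> Lp_mem M 1 S \<and> Lp_norm M 1 S \<le> C * Lp_norm lebesgue \<gamma> \<phi>"
proof -
  from assms(1) obtain c where [measurable]: "\<And>s. X s \<in> borel_measurable M"
    and indep: "\<And>m (t :: nat \<Rightarrow> real). strict_mono_on {..m} t \<Longrightarrow>
        prob_space.indep_vars M (\<lambda>_. borel) (\<lambda>j \<omega>. X (t (Suc j)) \<omega> - X (t j) \<omega>) {..<m}"
    and "c > 0" and cf: "\<And>s t u. (CLINT \<omega>|M. iexp (u * (X t \<omega> - X s \<omega>)))
        = complex_of_real (exp (- c * \<bar>t - s\<bar> * \<bar>u\<bar> powr \<gamma>))"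
    unfolding symmetric_stable_process_def by blast
  have "prob_space M" using assms(1) by (simp add: symmetric_stable_process_def)
  then interpret prob_space M .
  define K where "K = 2 * pi * (\<gamma> / (\<gamma> - 1)) * c powr (1 / \<gamma>)"
  have "K \<ge> 0" using assms(2) by (simp add: K_def)
  show ?thesis
  proof (intro exI[of _ "real DIM('b) * K"] conjI allI impI)
    show "0 \<le> real DIM('b) * K" using \<open>K \<ge> 0\<close> by simp
    fix a b :: real and \<phi> and S :: "'a \<Rightarrow> 'b"
    assume step: "step_integral X a b \<phi> S"
    then obtain m t d where t: "strict_mono_on {..m} t"
      and \<phi>: "\<phi> = (\<lambda>x. \<Sum>j<m. indicator {t j<..t (Suc j)} x *\<^sub>R d j)"
      and S: "S = (\<lambda>\<omega>. \<Sum>j<m. (X (t (Suc j)) \<omega> - X (t j) \<omega>) *\<^sub>R d j)"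
      unfolding step_integral_def by blast
    have [measurable]: "S \<in> borel_measurable M" unfolding S by measurable
    have le: "t j \<le> t (Suc j)" if "j < m" for j
      using strict_mono_on_leD[OF t, of j "Suc j"] that by auto
    define J where "J = (LINT x|lebesgue. norm (\<phi> x) powr \<gamma>)"
    have "norm (\<phi> x) powr \<gamma> = (\<Sum>j<m. indicator {t j<..t (Suc j)} x *\<^sub>R (norm (d j) powr \<gamma>))" for x
      unfolding \<phi> using t by (rule step_function_compose) simp
    then have J: "J = (\<Sum>j<m. (t (Suc j) - t j) * norm (d j) powr \<gamma>)"
      using has_bochner_integral_step_function[OF t, of "\<lambda>j. norm (d j) powr \<gamma>"]
      by (simp add: J_def has_bochner_integral_iff)
    \<comment> \<open>Each coordinate of S is a real combination of increments, hence a symmetric stable variable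
       whose scale is at most that given by the norms of the coefficients.\<close>
    have comp: "(\<integral>\<^sup>+\<omega>. ennreal \<bar>S \<omega> \<bullet> e\<bar> \<partial>M) \<le> ennreal (K * J powr (1 / \<gamma>))" if e: "e \<in> Basis" for e
    proof -
      define J' where "J' = (\<Sum>j<m. (t (Suc j) - t j) * \<bar>d j \<bullet> e\<bar> powr \<gamma>)"
      have "0 \<le> J'" unfolding J'_def using le by (intro sum_nonneg) auto
      have "J' \<le> J" unfolding J'_def J using le e assms(2)
        by (intro sum_mono mult_left_mono powr_mono2) (auto simp: Basis_le_norm)
      have Se: "(\<lambda>\<omega>. S \<omega> \<bullet> e) = (\<lambda>\<omega>. \<Sum>j<m. (X (t (Suc j)) \<omega> - X (t j) \<omega>) * (d j \<bullet> e))"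
        unfolding S by (simp add: inner_sum_left)
      have "(\<integral>\<^sup>+\<omega>. ennreal \<bar>S \<omega> \<bullet> e\<bar> \<partial>M) \<le> ennreal (2 * pi * (\<gamma> / (\<gamma> - 1)) * (c * J') powr (1 / \<gamma>))"
      proof (rule nn_integral_abs_stable_le[OF _ assms(2)])
        show "0 \<le> c * J'" using \<open>c > 0\<close> \<open>0 \<le> J'\<close> by simp
        show "char (distr M borel (\<lambda>\<omega>. S \<omega> \<bullet> e)) u = complex_of_real (exp (- (c * J') * \<bar>u\<bar> powr \<gamma>))" for u
          unfolding Se J'_def
          by (rule char_stable_combination[OF \<open>prob_space M\<close> _ indep[OF t] cf t]) measurable
      qed measurable
      also have "\<dots> \<le> ennreal (K * J powr (1 / \<gamma>))"
        using \<open>0 \<le> J'\<close> \<open>J' \<le> J\<close> \<open>c > 0\<close> assms(2)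
        by (intro ennreal_leI) (auto simp: K_def powr_mult intro!: divide_right_mono mult_left_mono powr_mono2)
      finally show ?thesis .
    qed
    have "(\<integral>\<^sup>+\<omega>. ennreal (norm (S \<omega>)) \<partial>M) \<le> (\<integral>\<^sup>+\<omega>. (\<Sum>e\<in>Basis. ennreal \<bar>S \<omega> \<bullet> e\<bar>) \<partial>M)"
      by (intro nn_integral_mono) (auto simp: sum_ennreal intro!: ennreal_leI norm_le_l1)
    also have "\<dots> = (\<Sum>e\<in>Basis. \<integral>\<^sup>+\<omega>. ennreal \<bar>S \<omega> \<bullet> e\<bar> \<partial>M)"
      by (intro nn_integral_sum) auto
    also have "\<dots> \<le> (\<Sum>e\<in>(Basis :: 'b set). ennreal (K * J powr (1 / \<gamma>)))"
      by (intro sum_mono comp)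
    also have "\<dots> = ennreal (real DIM('b) * K * J powr (1 / \<gamma>))"
      using \<open>K \<ge> 0\<close> by (simp add: ennreal_mult ennreal_of_nat_eq_real_of_nat mult.assoc)
    finally have bound: "(\<integral>\<^sup>+\<omega>. ennreal (norm (S \<omega>)) \<partial>M) \<le> ennreal (real DIM('b) * K * J powr (1 / \<gamma>))" .
    then have "integrable M (\<lambda>\<omega>. norm (S \<omega>))"
      by (auto simp: integrable_iff_bounded intro: le_less_trans)
    then show "Lp_mem M 1 S" by (simp add: Lp_mem_def)
    from \<open>integrable M _\<close> bound have "(LINT \<omega>|M. norm (S \<omega>)) \<le> real DIM('b) * K * J powr (1 / \<gamma>)"
      using \<open>K \<ge> 0\<close> by (simp add: nn_integral_eq_integral)
    then show "Lp_norm M 1 S \<le> real DIM('b) * K * Lp_norm lebesgue \<gamma> \<phi>"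
      by (simp add: Lp_norm_def J_def)
  qed
qed

section \<open>Convergence in \<open>L\<^sup>p\<close>\<close>

text \<open>A substitute for Minkowski's inequality that suffices for all limits below.\<close>

lemma norm_diff_powr_le:
  fixes a b :: "'b::real_normed_vector"
  assumes "0 \<le> p"
  shows "norm (a - b) powr p \<le> 2 powr p * (norm a powr p + norm b powr p)"
proof -
  have "norm (a - b) powr p \<le> (2 * max (norm a) (norm b)) powr p"
    using norm_triangle_ineq4[of a b] assms by (intro powr_mono2) auto
  also have "\<dots> = 2 powr p * max (norm a) (norm b) powr p"
    by (intro powr_mult)
  also have "\<dots> \<le> 2 powr p * (norm a powr p + norm b powr p)"
    by (intro mult_left_mono) (auto simp: max_def)
  finally show ?thesis .
qed

lemma Lp_mem_diff:
  assumes "0 < p" "Lp_mem M p f" "Lp_mem M p g"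
  shows "Lp_mem M p (\<lambda>x. f x - g x)"
  unfolding Lp_mem_def
proof
  have [measurable]: "f \<in> borel_measurable M" "g \<in> borel_measurable M"
    using assms by (auto simp: Lp_mem_def)
  show "(\<lambda>x. f x - g x) \<in> borel_measurable M" by measurable
  show "integrable M (\<lambda>x. norm (f x - g x) powr p)"
  proof (rule Bochner_Integration.integrable_bound)
    show "integrable M (\<lambda>x. 2 powr p * (norm (f x) powr p + norm (g x) powr p))"
      using assms by (auto simp: Lp_mem_def)
    show "AE x in M. norm (norm (f x - g x) powr p) \<le> norm (2 powr p * (norm (f x) powr p + norm (g x) powr p))"
      using norm_diff_powr_le[of p "f _" "g _"] assms(1) by (intro AE_I2) auto
  qed measurable
qed

lemma integral_norm_diff_powr_le:
  assumes "0 < p" "Lp_mem M p f" "Lp_mem M p g" "Lp_mem M p h"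
  shows "(LINT x|M. norm (f x - g x) powr p)
    \<le> 2 powr p * ((LINT x|M. norm (f x - h x) powr p) + (LINT x|M. norm (g x - h x) powr p))"
proof -
  have int: "integrable M (\<lambda>x. norm (f x - g x) powr p)" "integrable M (\<lambda>x. norm (f x - h x) powr p)"
    "integrable M (\<lambda>x. norm (g x - h x) powr p)"
    using assms Lp_mem_diff by (auto simp: Lp_mem_def)
  have "(LINT x|M. norm (f x - g x) powr p)
      \<le> (LINT x|M. 2 powr p * (norm (f x - h x) powr p + norm (g x - h x) powr p))"
  proof (intro integral_mono)
    show "norm (f x - g x) powr p \<le> 2 powr p * (norm (f x - h x) powr p + norm (g x - h x) powr p)" for x
      using norm_diff_powr_le[of p "f x - h x" "g x - h x"] assms(1) by simp
  qed (use int in auto)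
  then show ?thesis using int by simp
qed

lemma Lp_tendsto_iff_integral:
  assumes "0 < p"
  shows "Lp_tendsto M p F f \<longleftrightarrow> (\<forall>k. Lp_mem M p (F k)) \<and> Lp_mem M p f \<and>
    (\<lambda>k. LINT x|M. norm (F k x - f x) powr p) \<longlonglongrightarrow> 0"
proof -
  define J where "J k = (LINT x|M. norm (F k x - f x) powr p)" for k
  have J0: "J k \<ge> 0" for k by (simp add: J_def)
  have "J \<longlonglongrightarrow> 0" if "(\<lambda>k. J k powr (1 / p)) \<longlonglongrightarrow> 0"
  proof -
    have "(\<lambda>k. (J k powr (1 / p)) powr p) \<longlonglongrightarrow> 0 powr p"
      using assms that by (intro tendsto_powr') (auto intro!: tendsto_intros)
    then show ?thesis using assms J0 by (simp add: powr_powr)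
  qed
  moreover have "(\<lambda>k. J k powr (1 / p)) \<longlonglongrightarrow> 0" if "J \<longlonglongrightarrow> 0"
  proof -
    have "(\<lambda>k. J k powr (1 / p)) \<longlonglongrightarrow> 0 powr (1 / p)"
      using assms that J0 by (intro tendsto_powr') (auto intro!: tendsto_intros)
    then show ?thesis by simp
  qed
  ultimately show ?thesis unfolding Lp_tendsto_def Lp_norm_def J_def by blast
qed

lemma Lp_mem_1_iff: "Lp_mem M 1 f \<longleftrightarrow> integrable M f"
  unfolding Lp_mem_def by (auto simp: integrable_norm_iff)

lemma Lp_tendsto_1_iff: "Lp_tendsto M 1 F f \<longleftrightarrow> (\<forall>k. integrable M (F k)) \<and> integrable M f \<and>
    (\<lambda>k. LINT x|M. norm (F k x - f x)) \<longlonglongrightarrow> 0"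
  by (simp add: Lp_tendsto_iff_integral Lp_mem_1_iff)

lemma Lp_tendsto_perturb:
  assumes "0 < p" and F: "Lp_tendsto M p F f" and G: "\<And>n. Lp_mem M p (G n)"
    and close: "\<And>n. (LINT x|M. norm (G n x - F n x) powr p) \<le> inverse (real (Suc n))"
  shows "Lp_tendsto M p G f"
proof -
  have mem: "\<And>n. Lp_mem M p (F n)" "Lp_mem M p f"
    and lim: "(\<lambda>n. LINT x|M. norm (F n x - f x) powr p) \<longlonglongrightarrow> 0"
    using F assms(1) by (auto simp: Lp_tendsto_iff_integral)
  have "(\<lambda>n. LINT x|M. norm (G n x - f x) powr p) \<longlonglongrightarrow> 0"
  proof (rule tendsto_sandwich[OF _ _ tendsto_const])
    show "(\<lambda>n. 2 powr p * (inverse (real (Suc n)) + (LINT x|M. norm (F n x - f x) powr p))) \<longlonglongrightarrow> 0"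
      using tendsto_mult_left[OF tendsto_add[OF LIMSEQ_inverse_real_of_nat lim], of "2 powr p"] by simp
    have "(LINT x|M. norm (G n x - f x) powr p)
        \<le> 2 powr p * ((LINT x|M. norm (G n x - F n x) powr p) + (LINT x|M. norm (f x - F n x) powr p))" for n
      by (rule integral_norm_diff_powr_le[OF assms(1) G mem(2) mem(1)])
    also have "\<dots> n \<le> 2 powr p * (inverse (real (Suc n)) + (LINT x|M. norm (F n x - f x) powr p))" for n
      using close[of n] by (intro mult_left_mono add_mono) (auto simp: norm_minus_commute)
    finally show "\<forall>\<^sub>F n in sequentially. (LINT x|M. norm (G n x - f x) powr p)
        \<le> 2 powr p * (inverse (real (Suc n)) + (LINT x|M. norm (F n x - f x) powr p))"
      by (intro always_eventually allI)
  qed auto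
  then show ?thesis using assms(1) G mem by (simp add: Lp_tendsto_iff_integral)
qed

lemma Lp_tendsto_eventually_close:
  assumes "Lp_tendsto M p F f" "0 < p" "0 < e"
  shows "\<forall>\<^sub>F k in sequentially. (LINT x|M. norm (F k x - f x) powr p) < e"
  using assms by (auto simp: Lp_tendsto_iff_integral intro: order_tendstoD)

lemma Lp_mem_indicator:
  fixes f :: "'a \<Rightarrow> 'b::{real_normed_field, euclidean_space}"
  assumes "Lp_mem M p f" and [measurable]: "A \<in> sets M" and "0 < p"
  shows "Lp_mem M p (\<lambda>x. indicator A x *\<^sub>R f x)"
  unfolding Lp_mem_def
proof
  have [measurable]: "f \<in> borel_measurable M" using assms(1) by (simp add: Lp_mem_def)
  show "(\<lambda>x. indicator A x *\<^sub>R f x) \<in> borel_measurable M" by measurable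
  show "integrable M (\<lambda>x. norm (indicator A x *\<^sub>R f x) powr p)"
  proof (rule Bochner_Integration.integrable_bound)
    show "integrable M (\<lambda>x. norm (f x) powr p)" using assms(1) by (simp add: Lp_mem_def)
    show "AE x in M. norm (norm (indicator A x *\<^sub>R f x) powr p) \<le> norm (norm (f x) powr p)"
      using assms(3) by (intro AE_I2) (auto simp: indicator_def)
  qed measurable
qed

text \<open>Dominated convergence; used for the sets where a function is bounded by \<open>n\<close> and for the intervals
\<open>[-n, n]\<close>.\<close>

lemma Lp_tendsto_truncation:
  fixes f :: "'a \<Rightarrow> 'b::{real_normed_field, euclidean_space}"
  assumes f: "Lp_mem M p f" and "0 < p" and [measurable]: "\<And>n. A n \<in> sets M"
    and A: "\<And>x. x \<in> space M \<Longrightarrow> \<forall>\<^sub>F n in sequentially. x \<in> A n"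
  shows "Lp_tendsto M p (\<lambda>n x. indicator (A n) x *\<^sub>R f x) f"
proof -
  have [measurable]: "f \<in> borel_measurable M" using f by (simp add: Lp_mem_def)
  have "Lp_mem M p (\<lambda>x. indicator (A n) x *\<^sub>R f x)" for n
    using f \<open>0 < p\<close> by (intro Lp_mem_indicator) auto
  moreover have "(\<lambda>n. LINT x|M. norm (indicator (A n) x *\<^sub>R f x - f x) powr p) \<longlonglongrightarrow> (LINT x|M. 0 :: real)"
  proof (rule integral_dominated_convergence)
    show "integrable M (\<lambda>x. norm (f x) powr p)" using f by (simp add: Lp_mem_def)
    show "AE x in M. norm (norm (indicator (A n) x *\<^sub>R f x - f x) powr p) \<le> norm (f x) powr p" for n
      using \<open>0 < p\<close> by (intro AE_I2) (auto simp: indicator_def)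
    show "AE x in M. (\<lambda>n. norm (indicator (A n) x *\<^sub>R f x - f x) powr p) \<longlonglongrightarrow> 0"
    proof (rule AE_I2)
      fix x assume "x \<in> space M"
      from A[OF this] have "\<forall>\<^sub>F n in sequentially. 0 = norm (indicator (A n) x *\<^sub>R f x - f x) powr p"
        by eventually_elim simp
      then show "(\<lambda>n. norm (indicator (A n) x *\<^sub>R f x - f x) powr p) \<longlonglongrightarrow> 0"
        by (rule Lim_transform_eventually[OF tendsto_const])
    qed
  qed measurable
  ultimately show ?thesis using f \<open>0 < p\<close> by (simp add: Lp_tendsto_iff_integral)
qed

lemma Lp_mem_restrict_space:
  assumes "A \<inter> space M \<in> sets M"
  shows "Lp_mem (restrict_space M A) p f \<longleftrightarrow> Lp_mem M p (\<lambda>x. indicator A x *\<^sub>R f x)"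
proof -
  have "(\<lambda>x. indicator A x *\<^sub>R norm (f x) powr p) = (\<lambda>x. norm (indicator A x *\<^sub>R f x) powr p)"
    by (auto simp: indicator_def fun_eq_iff)
  then show ?thesis
    unfolding Lp_mem_def borel_measurable_restrict_space_iff[OF assms] integrable_restrict_space[OF assms]
    by (simp only:)
qed

text \<open>Convergence on a subset becomes convergence on the whole space to a truncated function, so that
integrals over different intervals can be compared.\<close>

lemma Lp_tendsto_restrict_space:
  assumes A: "A \<inter> space M \<in> sets M" and F: "\<And>k x. x \<notin> A \<Longrightarrow> F k x = 0"
  shows "Lp_tendsto (restrict_space M A) p F f \<longleftrightarrow> Lp_tendsto M p F (\<lambda>x. indicator A x *\<^sub>R f x)"
proof -
  have "(\<lambda>x. indicator A x *\<^sub>R F k x) = F k" for k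
    using F by (auto simp: indicator_def fun_eq_iff)
  moreover have "(\<lambda>x. indicator A x *\<^sub>R norm (F k x - f x) powr p)
      = (\<lambda>x. norm (F k x - indicator A x *\<^sub>R f x) powr p)" for k
    using F by (auto simp: indicator_def fun_eq_iff)
  ultimately show ?thesis
    unfolding Lp_tendsto_def Lp_norm_def Lp_mem_restrict_space[OF A] integral_restrict_space[OF A]
    by (simp only:)
qed

lemma L1_complete:
  fixes s :: "nat \<Rightarrow> 'a \<Rightarrow> 'b::{banach, second_countable_topology}"
  assumes int: "\<And>n. integrable M (s n)"
    and cauchy: "\<And>e. e > 0 \<Longrightarrow> \<exists>N. \<forall>i\<ge>N. \<forall>j\<ge>N. (LINT x|M. norm (s i x - s j x)) < e"
  obtains Z where "integrable M Z" "(\<lambda>n. LINT x|M. norm (s n x - Z x)) \<longlonglongrightarrow> 0"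
proof -
  obtain r where r: "strict_mono r" and ae: "AE x in M. Cauchy (\<lambda>i. s (r i) x)"
    using cauchy_L1_AE_cauchy_subseq[OF int cauchy] by blast
  have [measurable]: "s n \<in> borel_measurable M" for n using int by auto
  define Z where "Z x = lim (\<lambda>i. s (r i) x)" for x
  have [measurable]: "Z \<in> borel_measurable M" unfolding Z_def by measurable
  \<comment> \<open>Fatou's lemma along the subsequence.\<close>
  have bound: "\<exists>N. \<forall>i\<ge>N. (\<integral>\<^sup>+x. ennreal (norm (s i x - Z x)) \<partial>M) \<le> ennreal e" if "e > 0" for e
  proof -
    obtain N where N: "\<And>i j. i \<ge> N \<Longrightarrow> j \<ge> N \<Longrightarrow> (LINT x|M. norm (s i x - s j x)) < e"
      using cauchy[OF \<open>e > 0\<close>] by blast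
    have "(\<integral>\<^sup>+x. ennreal (norm (s i x - Z x)) \<partial>M) \<le> ennreal e" if "i \<ge> N" for i
    proof -
      have "(\<integral>\<^sup>+x. ennreal (norm (s i x - Z x)) \<partial>M)
          = (\<integral>\<^sup>+x. liminf (\<lambda>j. ennreal (norm (s i x - s (r j) x))) \<partial>M)"
      proof (intro nn_integral_cong_AE)
        show "AE x in M. ennreal (norm (s i x - Z x)) = liminf (\<lambda>j. ennreal (norm (s i x - s (r j) x)))"
          using ae
        proof eventually_elim
          case (elim x)
          then have "(\<lambda>j. s (r j) x) \<longlonglongrightarrow> Z x"
            unfolding Z_def by (simp add: Cauchy_convergent convergent_LIMSEQ_iff[symmetric])
          then have "(\<lambda>j. ennreal (norm (s i x - s (r j) x))) \<longlonglongrightarrow> ennreal (norm (s i x - Z x))"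
            by (intro tendsto_intros)
          then show ?case by (intro lim_imp_Liminf[symmetric]) auto
        qed
      qed
      also have "\<dots> \<le> liminf (\<lambda>j. \<integral>\<^sup>+x. ennreal (norm (s i x - s (r j) x)) \<partial>M)"
        by (rule nn_integral_liminf) measurable
      also have "\<dots> \<le> liminf (\<lambda>j::nat. ennreal e)"
      proof (rule Liminf_mono)
        show "\<forall>\<^sub>F j in sequentially. (\<integral>\<^sup>+x. ennreal (norm (s i x - s (r j) x)) \<partial>M) \<le> ennreal e"
          using eventually_ge_at_top[of N]
        proof eventually_elim
          case (elim j)
          then have "r j \<ge> N" using seq_suble[OF r, of j] by linarith
          then show ?case using N[OF \<open>i \<ge> N\<close>, of "r j"] int
            by (subst nn_integral_eq_integral) (auto intro!: ennreal_leI)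
        qed
      qed
      also have "\<dots> = ennreal e" by (simp add: Liminf_const)
      finally show ?thesis .
    qed
    then show ?thesis by blast
  qed
  obtain N where "(\<integral>\<^sup>+x. ennreal (norm (s N x - Z x)) \<partial>M) \<le> ennreal 1"
    using bound[of 1] by auto
  then have "integrable M (\<lambda>x. s N x - Z x)"
    by (intro integrableI_bounded) (auto intro: le_less_trans)
  from Bochner_Integration.integrable_diff[OF int[of N] this]
  have Z: "integrable M Z" by simp
  have "(\<lambda>n. LINT x|M. norm (s n x - Z x)) \<longlonglongrightarrow> 0"
  proof (rule LIMSEQ_I)
    fix e :: real assume "e > 0"
    then obtain N where N: "\<And>i. i \<ge> N \<Longrightarrow> (\<integral>\<^sup>+x. ennreal (norm (s i x - Z x)) \<partial>M) \<le> ennreal (e / 2)"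
      using bound[of "e / 2"] by auto
    have "norm ((LINT x|M. norm (s i x - Z x)) - 0) < e" if "i \<ge> N" for i
    proof -
      have "ennreal (LINT x|M. norm (s i x - Z x)) \<le> ennreal (e / 2)"
        using N[OF that] int Z by (subst nn_integral_eq_integral[symmetric]) auto
      then show ?thesis using \<open>e > 0\<close> by (simp add: ennreal_le_iff)
    qed
    then show "\<exists>N. \<forall>i\<ge>N. norm ((LINT x|M. norm (s i x - Z x)) - 0) < e" by blast
  qed
  with Z show thesis by (rule that)
qed

section \<open>Density of step functions\<close>

lemma step_function_uniform_approx:
  fixes g :: "real \<Rightarrow> 'b::real_normed_vector"
  assumes "continuous_on {a..b} g" and "a < b" and "0 < e"
  shows "\<exists>m t c. strict_mono_on {..m} t \<and> t ` {..m} \<subseteq> {a..b} \<and>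
    (\<forall>x\<in>{a<..b}. norm ((\<Sum>j<m. indicator {t j<..t (Suc j)} x *\<^sub>R c j) - g x) < e)"
proof -
  have "uniformly_continuous_on {a..b} g"
    using assms(1) by (intro compact_uniformly_continuous) auto
  then obtain \<delta> where "\<delta> > 0"
    and \<delta>: "\<And>x y. x \<in> {a..b} \<Longrightarrow> y \<in> {a..b} \<Longrightarrow> dist x y < \<delta> \<Longrightarrow> dist (g x) (g y) < e"
    using \<open>0 < e\<close> unfolding uniformly_continuous_on_def by metis
  obtain m :: nat where m: "(b - a) / \<delta> < real m" using reals_Archimedean2 by blast
  have "m > 0" using m \<open>\<delta> > 0\<close> \<open>a < b\<close> by (cases m) (auto simp: field_simps)
  define h where "h = (b - a) / real m"
  have h: "0 < h" "h < \<delta>" "real m * h = b - a"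
    using m \<open>m > 0\<close> \<open>\<delta> > 0\<close> \<open>a < b\<close> by (auto simp: h_def field_simps)
  define t where "t j = a + real j * h" for j
  have mono: "strict_mono_on {..m} t"
    using h by (intro strict_mono_onI) (simp add: t_def)
  have ran: "t j \<in> {a..b}" if "j \<le> m" for j
  proof -
    have "real j * h \<le> real m * h" using that h by (intro mult_right_mono) auto
    then show ?thesis using h by (simp add: t_def)
  qed
  show ?thesis
  proof (intro exI[of _ m] exI[of _ t] exI[of _ "\<lambda>j. g (t (Suc j))"] conjI mono ballI)
    show "t ` {..m} \<subseteq> {a..b}" using ran by auto
    fix x assume x: "x \<in> {a<..b}"
    have "x \<le> t m" "\<not> x \<le> t 0" using x h by (auto simp: t_def)
    then obtain j where j: "j < m" "\<not> x \<le> t j" "x \<le> t (Suc j)"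
      using ex_least_nat_less[of "\<lambda>j. x \<le> t j" m] by auto
    have "t (Suc j) - t j = h" by (simp add: t_def algebra_simps)
    then have "dist (t (Suc j)) x < \<delta>" using j h by (auto simp: dist_real_def)
    then have "dist (g (t (Suc j))) (g x) < e" using x ran[of "Suc j"] j(1) by (intro \<delta>) auto
    moreover have "(\<Sum>j<m. indicator {t j<..t (Suc j)} x *\<^sub>R g (t (Suc j))) = g (t (Suc j))"
      using j by (intro step_function_eq[OF mono]) auto
    ultimately show "norm ((\<Sum>j<m. indicator {t j<..t (Suc j)} x *\<^sub>R g (t (Suc j))) - g x) < e"
      by (simp only: dist_norm)
  qed
qed

text \<open>A measurable function is almost everywhere a limit of continuous functions, and each of these is
uniformly close to a step function on the interval. After large values are removed, dominated
convergence applies.\<close>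

lemma step_functions_dense_bounded:
  fixes f :: "real \<Rightarrow> 'b::{real_normed_field, euclidean_space}"
  assumes f: "Lp_mem lebesgue p f" and B: "\<And>x. norm (f x) \<le> B"
    and "a < b" and "0 < p"
  shows "\<exists>\<phi> S. (\<forall>k. step_integral X a b (\<phi> k) (S k)) \<and>
    Lp_tendsto lebesgue p \<phi> (\<lambda>x. indicator {a..b} x *\<^sub>R f x)"
proof -
  have fm [measurable]: "f \<in> borel_measurable lebesgue" using f by (simp add: Lp_mem_def)
  obtain N g where "negligible N" and g: "\<And>n. continuous_on UNIV (g n)"
    and gf: "\<And>x. x \<notin> N \<Longrightarrow> (\<lambda>n. g n x) \<longlonglongrightarrow> f x"
    using lebesgue_measurable_imp_measurable_on[OF fm, of UNIV]
    unfolding measurable_on_def by auto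
  define approx where "approx n m t c \<longleftrightarrow> strict_mono_on {..m} t \<and> t ` {..m} \<subseteq> {a..b} \<and>
    (\<forall>x\<in>{a<..b}. norm ((\<Sum>j<m. indicator {t j<..t (Suc j)} x *\<^sub>R c j) - g n x) < inverse (real (Suc n)))"
    for n m t and c :: "nat \<Rightarrow> 'b"
  have "\<exists>m t c. approx n m t c" for n
    unfolding approx_def using g[of n] \<open>a < b\<close>
    by (intro step_function_uniform_approx) (auto intro: continuous_on_subset)
  then obtain m t c where "\<And>n. approx n (m n) (t n) (c n)"
    by metis
  then have t: "\<And>n. strict_mono_on {..m n} (t n)" "\<And>n. t n ` {..m n} \<subseteq> {a..b}"
    and c: "\<And>n x. x \<in> {a<..b} \<Longrightarrow>
      norm ((\<Sum>j<m n. indicator {t n j<..t n (Suc j)} x *\<^sub>R c n j) - g n x) < inverse (real (Suc n))"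
    unfolding approx_def by blast+
  \<comment> \<open>Large values are replaced by 0 to obtain a common bound. As f stays strictly below the threshold
     \<open>B + 1\<close>, this eventually changes nothing at a point of convergence.\<close>
  define clip where "clip v = (if norm v \<le> B + 1 then v else 0)" for v :: 'b
  have "0 \<le> B" using B[of 0] norm_ge_zero order_trans by blast
  have clip_le: "norm (clip v) \<le> B + 1" for v using \<open>0 \<le> B\<close> by (simp add: clip_def)
  define s where "s n x = (\<Sum>j<m n. indicator {t n j<..t n (Suc j)} x *\<^sub>R c n j)" for n x
  define \<phi> where "\<phi> n x = (\<Sum>j<m n. indicator {t n j<..t n (Suc j)} x *\<^sub>R clip (c n j))" for n x
  define S where "S n \<omega> = (\<Sum>j<m n. (X (t n (Suc j)) \<omega> - X (t n j) \<omega>) *\<^sub>R clip (c n j))" for n \<omega>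
  have \<phi>s: "\<phi> n x = clip (s n x)" for n x
    unfolding \<phi>_def s_def by (rule step_function_compose[OF t(1), symmetric]) (simp add: clip_def)
  have step: "step_integral X a b (\<phi> n) (S n)" for n
    unfolding step_integral_def \<phi>_def S_def
    by (intro exI[of _ "m n"] exI[of _ "t n"] exI[of _ "\<lambda>j. clip (c n j)"] conjI t refl)
  have mem: "Lp_mem lebesgue p (\<phi> n)" for n using step \<open>0 < p\<close> by (rule step_integral_Lp_mem)
  then have [measurable]: "\<phi> n \<in> borel_measurable lebesgue" for n by (simp add: Lp_mem_def)
  have out: "\<phi> n x = 0" if "x \<notin> {a<..b}" for n x
    unfolding \<phi>_def using t that by (rule step_function_eq_0)
  have lim: "(\<lambda>n. \<phi> n x) \<longlonglongrightarrow> f x" if x: "x \<in> {a<..b}" "x \<notin> N" for x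
  proof -
    have "(\<lambda>n. s n x - g n x) \<longlonglongrightarrow> 0"
      by (rule tendsto_norm_zero_cancel, rule tendsto_sandwich[OF _ _ tendsto_const LIMSEQ_inverse_real_of_nat])
        (use c[OF x(1)] in \<open>auto simp: s_def intro!: always_eventually less_imp_le\<close>)
    from tendsto_add[OF this gf[OF x(2)]] have s: "(\<lambda>n. s n x) \<longlonglongrightarrow> f x" by simp
    have "norm (f x) < B + 1" using B[of x] by simp
    from order_tendstoD(2)[OF tendsto_norm[OF s] this]
    have "\<forall>\<^sub>F n in sequentially. s n x = \<phi> n x"
      by eventually_elim (simp add: \<phi>s clip_def)
    then show ?thesis by (rule Lim_transform_eventually[OF s])
  qed
  have ae: "AE x in lebesgue. (\<lambda>n. \<phi> n x) \<longlonglongrightarrow> indicator {a..b} x *\<^sub>R f x"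
  proof -
    have "N \<union> {a} \<in> null_sets lebesgue"
      using \<open>negligible N\<close> by (simp add: negligible_iff_null_sets[symmetric])
    then have "AE x in lebesgue. x \<notin> N \<union> {a}" by (rule AE_not_in)
    then show ?thesis
    proof eventually_elim
      case (elim x)
      show ?case
      proof (cases "x \<in> {a<..b}")
        case True
        then show ?thesis using lim[OF True] elim by simp
      next
        case False
        then show ?thesis using elim out[OF False] by (auto simp: indicator_def)
      qed
    qed
  qed
  have dom: "norm (norm (\<phi> n x - indicator {a..b} x *\<^sub>R f x) powr p) \<le> indicator {a..b} x *\<^sub>R (2 * B + 1) powr p" for n x
  proof (cases "x \<in> {a..b}")
    case True
    have "norm (\<phi> n x - f x) \<le> 2 * B + 1"
      using norm_triangle_ineq4[of "\<phi> n x" "f x"] clip_le[of "s n x"] B[of x] by (simp add: \<phi>s)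
    then show ?thesis using True \<open>0 < p\<close> by (auto intro!: powr_mono2)
  next
    case False
    then show ?thesis using out[of x n] by auto
  qed
  have ind: "integrable lebesgue (\<lambda>x. indicator {a..b} x *\<^sub>R K)" for K :: real
    by (intro integrable_scaleR_left integrable_real_indicator) (auto simp: emeasure_lborel_Icc_eq)
  have f_ab: "Lp_mem lebesgue p (\<lambda>x. indicator {a..b} x *\<^sub>R f x)"
    using f \<open>0 < p\<close> by (intro Lp_mem_indicator) auto
  have meas: "(\<lambda>x. norm (\<phi> n x - indicator {a..b} x *\<^sub>R f x) powr p) \<in> borel_measurable lebesgue" for n
    using Lp_mem_diff[OF \<open>0 < p\<close> mem f_ab, of n] unfolding Lp_mem_def by (blast intro: borel_measurable_integrable)
  have "(\<lambda>n. LINT x|lebesgue. norm (\<phi> n x - indicator {a..b} x *\<^sub>R f x) powr p)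
    \<longlonglongrightarrow> (LINT x|(lebesgue :: real measure). 0 :: real)"
  proof (rule integral_dominated_convergence[OF _ meas ind[of "(2 * B + 1) powr p"]])
    show "AE x in lebesgue. (\<lambda>n. norm (\<phi> n x - indicator {a..b} x *\<^sub>R f x) powr p) \<longlonglongrightarrow> 0"
      using ae
    proof eventually_elim
      case (elim x)
      then have "(\<lambda>n. norm (\<phi> n x - indicator {a..b} x *\<^sub>R f x)) \<longlonglongrightarrow> 0"
        by (intro tendsto_norm_zero) (simp add: LIM_zero)
      then have "(\<lambda>n. norm (\<phi> n x - indicator {a..b} x *\<^sub>R f x) powr p) \<longlonglongrightarrow> 0 powr p"
        using \<open>0 < p\<close> by (intro tendsto_powr') (auto intro: tendsto_intros)
      then show ?case by simp
    qed
    show "AE x in lebesgue. norm (norm (\<phi> n x - indicator {a..b} x *\<^sub>R f x) powr p)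
        \<le> indicator {a..b} x *\<^sub>R (2 * B + 1) powr p" for n
      using dom by (rule AE_I2)
  qed simp
  with f_ab have "Lp_tendsto lebesgue p \<phi> (\<lambda>x. indicator {a..b} x *\<^sub>R f x)"
    using mem \<open>0 < p\<close> by (simp add: Lp_tendsto_iff_integral)
  with step show ?thesis by blast
qed

text \<open>Degenerate intervals are included because the sequence of intervals \<open>[-n, n]\<close> starts with one of them.\<close>

lemma step_functions_dense:
  fixes f :: "real \<Rightarrow> 'b::{real_normed_field, euclidean_space}"
  assumes f: "Lp_mem lebesgue p f" and "a \<le> b" and "0 < p"
  shows "\<exists>\<phi> S. (\<forall>k. step_integral X a b (\<phi> k) (S k)) \<and>
    Lp_tendsto lebesgue p \<phi> (\<lambda>x. indicator {a..b} x *\<^sub>R f x)"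
proof (cases "a = b")
  case True
  have zero: "step_integral X a b (\<lambda>x. 0 :: 'b) (\<lambda>\<omega>. 0)"
    unfolding step_integral_def using True
    by (intro exI[of _ 0] exI[of _ "\<lambda>_. a"] exI[of _ "\<lambda>_. 0"]) (auto intro: strict_mono_onI)
  have "AE x in lebesgue. x \<notin> {a}" by (rule AE_not_in) (simp add: negligible_iff_null_sets[symmetric])
  then have "(LINT x|lebesgue. norm (0 - indicator {a..b} x *\<^sub>R f x) powr p) = 0"
    using True by (intro integral_eq_zero_AE) (auto elim!: eventually_mono)
  moreover have "Lp_mem lebesgue p (\<lambda>x. indicator {a..b} x *\<^sub>R f x)"
    using f \<open>0 < p\<close> by (intro Lp_mem_indicator) auto
  ultimately have "Lp_tendsto lebesgue p (\<lambda>k x. 0) (\<lambda>x. indicator {a..b} x *\<^sub>R f x)"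
    using \<open>0 < p\<close> step_integral_Lp_mem[OF zero] by (simp add: Lp_tendsto_iff_integral)
  with zero show ?thesis by (intro exI[of _ "\<lambda>k x. 0"] exI[of _ "\<lambda>k \<omega>. 0"]) auto
next
  case False
  then have "a < b" using \<open>a \<le> b\<close> by simp
  have fm [measurable]: "f \<in> borel_measurable lebesgue" using f by (simp add: Lp_mem_def)
  define g where "g x = indicator {a..b} x *\<^sub>R f x" for x
  have g: "Lp_mem lebesgue p g" unfolding g_def
    using f \<open>0 < p\<close> by (intro Lp_mem_indicator) auto
  \<comment> \<open>Truncation to the sets where f is bounded by n reduces to bounded functions.\<close>
  define A where "A n = {x \<in> space lebesgue. norm (f x) \<le> real n}" for n :: nat
  have A [measurable]: "A n \<in> sets lebesgue" for n unfolding A_def by measurable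
  have trunc: "Lp_tendsto lebesgue p (\<lambda>n x. indicator (A n) x *\<^sub>R g x) g"
  proof (rule Lp_tendsto_truncation[OF g \<open>0 < p\<close> A])
    fix x :: real
    show "\<forall>\<^sub>F n in sequentially. x \<in> A n"
      using eventually_ge_at_top[of "nat \<lceil>norm (f x)\<rceil>"]
      by eventually_elim (simp add: A_def nat_ceiling_le_eq)
  qed
  have "\<exists>\<psi> T. step_integral X a b \<psi> T \<and>
      (LINT x|lebesgue. norm (\<psi> x - indicator (A n) x *\<^sub>R g x) powr p) \<le> inverse (real (Suc n))" for n
  proof -
    have "\<exists>\<phi> S. (\<forall>k. step_integral X a b (\<phi> k) (S k)) \<and>
        Lp_tendsto lebesgue p \<phi> (\<lambda>x. indicator {a..b} x *\<^sub>R (indicator (A n) x *\<^sub>R f x))"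
    proof (rule step_functions_dense_bounded[where B="real n"])
      show "Lp_mem lebesgue p (\<lambda>x. indicator (A n) x *\<^sub>R f x)"
        using f A \<open>0 < p\<close> by (rule Lp_mem_indicator)
      show "norm (indicator (A n) x *\<^sub>R f x) \<le> real n" for x
        by (cases "x \<in> A n") (simp_all add: A_def)
    qed fact+
    then obtain \<phi> S where step: "\<And>k. step_integral X a b (\<phi> k) (S k)"
      and lim: "Lp_tendsto lebesgue p \<phi> (\<lambda>x. indicator (A n) x *\<^sub>R g x)"
      by (auto simp: g_def mult.commute)
    from Lp_tendsto_eventually_close[OF lim \<open>0 < p\<close>, of "inverse (real (Suc n))"]
    obtain k where "(LINT x|lebesgue. norm (\<phi> k x - indicator (A n) x *\<^sub>R g x) powr p) < inverse (real (Suc n))"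
      by (auto simp: eventually_sequentially)
    with step show ?thesis by (meson less_imp_le)
  qed
  then obtain \<psi> T where step: "\<And>n. step_integral X a b (\<psi> n) (T n)"
    and close: "\<And>n. (LINT x|lebesgue. norm (\<psi> n x - indicator (A n) x *\<^sub>R g x) powr p) \<le> inverse (real (Suc n))"
    by metis
  have "Lp_tendsto lebesgue p \<psi> g"
    using \<open>0 < p\<close> trunc step_integral_Lp_mem[OF step \<open>0 < p\<close>] close by (rule Lp_tendsto_perturb)
  with step show ?thesis unfolding g_def by blast
qed

section \<open>Existence of the stochastic integral\<close>

text \<open>The bound on differences makes the integrals of any two sequences of step functions with the same
limit asymptotically equal, and Cauchy when the two sequences coincide. One limit \<open>Z\<close> thus serves all
sequences. The intervals may vary with the sequence index, so that the same statement yields the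
integral over a bounded interval and the integral over the line. If no sequence of step functions
converges to \<open>f\<close>, any \<open>Z\<close> will do.\<close>

lemma step_integrals_converge:
  fixes X :: "real \<Rightarrow> 'a \<Rightarrow> real" and f :: "real \<Rightarrow> 'b::{real_normed_field, euclidean_space}"
  assumes "symmetric_stable_process M X \<gamma>" and "1 < \<gamma>"
  shows "\<exists>Z. \<forall>\<phi> S. (\<forall>k. \<exists>a b. step_integral X a b (\<phi> k) (S k)) \<longrightarrow> Lp_tendsto lebesgue \<gamma> \<phi> f
    \<longrightarrow> Lp_tendsto M 1 S Z"
proof -
  obtain C where "C \<ge> 0" and C: "\<And>a b \<phi> (S :: 'a \<Rightarrow> 'b). step_integral X a b \<phi> S \<Longrightarrow>
      Lp_mem M 1 S \<and> Lp_norm M 1 S \<le> C * Lp_norm lebesgue \<gamma> \<phi>"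
    using step_integral_norm_bound[OF assms, where 'b='b] by metis
  define admissible where "admissible \<phi> S \<longleftrightarrow>
    (\<forall>k. \<exists>a b. step_integral X a b (\<phi> k) (S k)) \<and> Lp_tendsto lebesgue \<gamma> \<phi> f"
    for \<phi> and S :: "nat \<Rightarrow> 'a \<Rightarrow> 'b"
  have int: "integrable M (S k)" if "admissible \<phi> S" for \<phi> S k
    using that C unfolding admissible_def by (metis Lp_mem_1_iff)
  have close: "\<exists>N. \<forall>i\<ge>N. \<forall>j\<ge>N. (LINT \<omega>|M. norm (S i \<omega> - T j \<omega>)) < e"
    if S: "admissible \<phi> S" and T: "admissible \<psi> T" and "e > 0" for \<phi> \<psi> S T e
  proof -
    \<comment> \<open>Chosen so that the quasi-triangle inequality with two errors \<open>\<delta>\<close> gives exactly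
       \<open>(e / (C + 1)) powr \<gamma>\<close>; the summand 1 covers \<open>C = 0\<close>.\<close>
    define \<delta> where "\<delta> = (e / (C + 1)) powr \<gamma> / (2 powr \<gamma> * 2)"
    have "\<delta> > 0" using \<open>e > 0\<close> \<open>C \<ge> 0\<close> by (simp add: \<delta>_def)
    have conv: "(\<lambda>k. LINT x|lebesgue. norm (\<phi> k x - f x) powr \<gamma>) \<longlonglongrightarrow> 0"
      "(\<lambda>k. LINT x|lebesgue. norm (\<psi> k x - f x) powr \<gamma>) \<longlonglongrightarrow> 0"
      and mem: "\<And>k. Lp_mem lebesgue \<gamma> (\<phi> k)" "\<And>k. Lp_mem lebesgue \<gamma> (\<psi> k)" "Lp_mem lebesgue \<gamma> f"
      using S T assms(2) by (auto simp: admissible_def Lp_tendsto_iff_integral)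
    have "\<forall>\<^sub>F k in sequentially. (LINT x|lebesgue. norm (\<phi> k x - f x) powr \<gamma>) < \<delta>
        \<and> (LINT x|lebesgue. norm (\<psi> k x - f x) powr \<gamma>) < \<delta>"
      using order_tendstoD(2)[OF conv(1) \<open>\<delta> > 0\<close>] order_tendstoD(2)[OF conv(2) \<open>\<delta> > 0\<close>]
      by eventually_elim simp
    then obtain N where N: "\<And>k. k \<ge> N \<Longrightarrow> (LINT x|lebesgue. norm (\<phi> k x - f x) powr \<gamma>) < \<delta>"
      "\<And>k. k \<ge> N \<Longrightarrow> (LINT x|lebesgue. norm (\<psi> k x - f x) powr \<gamma>) < \<delta>"
      unfolding eventually_sequentially by blast
    have "(LINT \<omega>|M. norm (S i \<omega> - T j \<omega>)) < e" if "i \<ge> N" "j \<ge> N" for i j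
    proof -
      have "(LINT x|lebesgue. norm (\<phi> i x - \<psi> j x) powr \<gamma>)
          \<le> 2 powr \<gamma> * ((LINT x|lebesgue. norm (\<phi> i x - f x) powr \<gamma>) + (LINT x|lebesgue. norm (\<psi> j x - f x) powr \<gamma>))"
        using assms(2) mem by (intro integral_norm_diff_powr_le) auto
      also have "\<dots> \<le> 2 powr \<gamma> * (\<delta> + \<delta>)"
        using N(1)[OF that(1)] N(2)[OF that(2)] by (intro mult_left_mono add_mono) auto
      also have "\<dots> = (e / (C + 1)) powr \<gamma>" by (simp add: \<delta>_def)
      finally have "(LINT x|lebesgue. norm (\<phi> i x - \<psi> j x) powr \<gamma>) powr (1 / \<gamma>)
          \<le> ((e / (C + 1)) powr \<gamma>) powr (1 / \<gamma>)"
        using assms(2) by (intro powr_mono2) auto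
      also have "\<dots> = e / (C + 1)" using assms(2) \<open>e > 0\<close> \<open>C \<ge> 0\<close> by (simp add: powr_powr)
      finally have le: "Lp_norm lebesgue \<gamma> (\<lambda>x. \<phi> i x - \<psi> j x) \<le> e / (C + 1)"
        by (simp add: Lp_norm_def)
      obtain a b a' b' where "step_integral X a b (\<phi> i) (S i)" "step_integral X a' b' (\<psi> j) (T j)"
        using S T unfolding admissible_def by blast
      from C[OF step_integral_diff[OF this]]
      have "(LINT \<omega>|M. norm (S i \<omega> - T j \<omega>)) \<le> C * Lp_norm lebesgue \<gamma> (\<lambda>x. \<phi> i x - \<psi> j x)"
        by (simp add: Lp_norm_def)
      also have "\<dots> \<le> C * (e / (C + 1))" using le \<open>C \<ge> 0\<close> by (rule mult_left_mono)
      also have "\<dots> < e" using \<open>C \<ge> 0\<close> \<open>e > 0\<close> by (simp add: field_simps)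
      finally show ?thesis .
    qed
    then show ?thesis by blast
  qed
  show ?thesis
  proof (cases "\<exists>\<phi> S. admissible \<phi> S")
    case True
    then obtain \<phi>0 S0 where adm0: "admissible \<phi>0 S0" by blast
    obtain Z where Z: "integrable M Z" and lim: "(\<lambda>n. LINT \<omega>|M. norm (S0 n \<omega> - Z \<omega>)) \<longlonglongrightarrow> 0"
      using L1_complete[of M S0] int[OF adm0] close[OF adm0 adm0] by blast
    have "Lp_tendsto M 1 S Z" if S: "admissible \<phi> S" for \<phi> S
      unfolding Lp_tendsto_1_iff
    proof (intro conjI allI int[OF S] Z)
      have diff: "(\<lambda>n. LINT \<omega>|M. norm (S n \<omega> - S0 n \<omega>)) \<longlonglongrightarrow> 0"
      proof (rule LIMSEQ_I)
        fix e :: real assume "e > 0"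
        from close[OF S adm0 this]
        show "\<exists>N. \<forall>n\<ge>N. norm ((LINT \<omega>|M. norm (S n \<omega> - S0 n \<omega>)) - 0) < e" by auto
      qed
      show "(\<lambda>n. LINT \<omega>|M. norm (S n \<omega> - Z \<omega>)) \<longlonglongrightarrow> 0"
      proof (rule tendsto_sandwich[OF _ _ tendsto_const])
        show "(\<lambda>n. (LINT \<omega>|M. norm (S n \<omega> - S0 n \<omega>)) + (LINT \<omega>|M. norm (S0 n \<omega> - Z \<omega>))) \<longlonglongrightarrow> 0"
          using tendsto_add[OF diff lim] by simp
        have "(LINT \<omega>|M. norm (S n \<omega> - Z \<omega>)) \<le> (LINT \<omega>|M. norm (S n \<omega> - S0 n \<omega>) + norm (S0 n \<omega> - Z \<omega>))" for n
          using int[OF S] int[OF adm0] Z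
          by (intro integral_mono) (auto intro: norm_diff_triangle_le)
        then show "\<forall>\<^sub>F n in sequentially. (LINT \<omega>|M. norm (S n \<omega> - Z \<omega>))
            \<le> (LINT \<omega>|M. norm (S n \<omega> - S0 n \<omega>)) + (LINT \<omega>|M. norm (S0 n \<omega> - Z \<omega>))"
          using int[OF S] int[OF adm0] Z by simp
      qed auto
    qed
    then show ?thesis unfolding admissible_def by blast
  next
    case False
    then show ?thesis unfolding admissible_def by blast
  qed
qed

lemma Lp_tendsto_lebesgue_on_step:
  assumes "\<And>k. step_integral X a b (\<phi> k) (S k)"
  shows "Lp_tendsto (lebesgue_on {a..b}) p \<phi> f \<longleftrightarrow> Lp_tendsto lebesgue p \<phi> (\<lambda>x. indicator {a..b} x *\<^sub>R f x)"
proof (rule Lp_tendsto_restrict_space)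
  fix k x assume x: "x \<notin> {a..b}"
  obtain m t c where t: "strict_mono_on {..m} t" "t ` {..m} \<subseteq> {a..b}"
    and \<phi>: "\<phi> k = (\<lambda>x. \<Sum>j<m. indicator {t j<..t (Suc j)} x *\<^sub>R c j)"
    using assms[of k] unfolding step_integral_def by blast
  have "x \<notin> {a<..b}" using x by auto
  then show "\<phi> k x = 0" unfolding \<phi> by (rule step_function_eq_0[OF t])
qed simp

lemma has_stoch_integral_exists:
  fixes X :: "real \<Rightarrow> 'a \<Rightarrow> real" and f :: "real \<Rightarrow> 'b::{real_normed_field, euclidean_space}"
  assumes "symmetric_stable_process M X \<gamma>" and "1 < \<gamma>" and "Lp_mem lebesgue \<gamma> f" and "a \<le> b"
  shows "\<exists>Y. has_stoch_integral M X \<gamma> a b f Y"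
proof -
  obtain Y where Y: "\<And>\<phi> S. (\<And>k. \<exists>a b. step_integral X a b (\<phi> k) (S k)) \<Longrightarrow>
      Lp_tendsto lebesgue \<gamma> \<phi> (\<lambda>x. indicator {a..b} x *\<^sub>R f x) \<Longrightarrow> Lp_tendsto M 1 S Y"
    using step_integrals_converge[OF assms(1,2), of "\<lambda>x. indicator {a..b} x *\<^sub>R f x"] by auto
  obtain \<phi> and S :: "nat \<Rightarrow> 'a \<Rightarrow> 'b" where step: "\<And>k. step_integral X a b (\<phi> k) (S k)"
    and lim: "Lp_tendsto lebesgue \<gamma> \<phi> (\<lambda>x. indicator {a..b} x *\<^sub>R f x)"
    using step_functions_dense[OF assms(3,4), of X] assms(2) by auto
  have "has_stoch_integral M X \<gamma> a b f Y"
    unfolding has_stoch_integral_def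
  proof (intro conjI allI impI)
    show "\<exists>\<phi> S. (\<forall>k. step_integral X a b (\<phi> k) (S k)) \<and> Lp_tendsto (lebesgue_on {a..b}) \<gamma> \<phi> f"
      using step lim by (intro exI[of _ \<phi>] exI[of _ S] conjI allI) (simp_all add: Lp_tendsto_lebesgue_on_step[OF step])
  next
    fix \<psi> and T :: "nat \<Rightarrow> 'a \<Rightarrow> 'b"
    assume T: "\<forall>k. step_integral X a b (\<psi> k) (T k)" and "Lp_tendsto (lebesgue_on {a..b}) \<gamma> \<psi> f"
    then have "Lp_tendsto lebesgue \<gamma> \<psi> (\<lambda>x. indicator {a..b} x *\<^sub>R f x)"
      by (simp add: Lp_tendsto_lebesgue_on_step[of X a b \<psi> T])
    with T show "Lp_tendsto M 1 T Y" by (intro Y) auto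
  qed
  then show ?thesis by (rule exI[of _ Y])
qed

text \<open>The integral is a limit along sequences of step functions; a single step function that is close in
both norms is what the diagonal argument over \<open>n\<close> needs.\<close>

lemma has_stoch_integral_approx:
  assumes "has_stoch_integral M X \<gamma> a b f Y" and "0 < \<gamma>" and "0 < e"
  shows "\<exists>\<phi> S. step_integral X a b \<phi> S \<and> integrable M Y
    \<and> (LINT x|lebesgue. norm (\<phi> x - indicator {a..b} x *\<^sub>R f x) powr \<gamma>) \<le> e
    \<and> (LINT \<omega>|M. norm (Y \<omega> - S \<omega>)) \<le> e"
proof -
  obtain \<phi> S where step: "\<And>k. step_integral X a b (\<phi> k) (S k)"
    and lim: "Lp_tendsto (lebesgue_on {a..b}) \<gamma> \<phi> f" and S: "Lp_tendsto M 1 S Y"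
    using assms(1) unfolding has_stoch_integral_def by blast
  have lim': "Lp_tendsto lebesgue \<gamma> \<phi> (\<lambda>x. indicator {a..b} x *\<^sub>R f x)"
    using lim by (simp add: Lp_tendsto_lebesgue_on_step[OF step])
  have "\<forall>\<^sub>F k in sequentially. (LINT x|lebesgue. norm (\<phi> k x - indicator {a..b} x *\<^sub>R f x) powr \<gamma>) < e
      \<and> (LINT \<omega>|M. norm (S k \<omega> - Y \<omega>)) < e"
    using Lp_tendsto_eventually_close[OF lim' assms(2,3)] Lp_tendsto_eventually_close[OF S _ assms(3)]
    by (simp add: eventually_conj_iff)
  then obtain k where "(LINT x|lebesgue. norm (\<phi> k x - indicator {a..b} x *\<^sub>R f x) powr \<gamma>) < e"
    "(LINT \<omega>|M. norm (S k \<omega> - Y \<omega>)) < e"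
    by (auto simp: eventually_sequentially)
  moreover have "integrable M Y" using S by (simp add: Lp_tendsto_1_iff)
  ultimately show ?thesis using step[of k]
    by (intro exI[of _ "\<phi> k"] exI[of _ "S k"]) (simp add: norm_minus_commute)
qed

theorem theorem5:
  fixes M :: "'a measure"
    and X :: "real \<Rightarrow> 'a \<Rightarrow> real"
    and f :: "real \<Rightarrow> 'b::{real_normed_field, euclidean_space}"
    and \<gamma> :: real
  assumes "1 < \<gamma>" and "\<gamma> \<le> 2"
    and "symmetric_stable_process M X \<gamma>"
    and "Lp_mem lebesgue 1 f" and "Lp_mem lebesgue \<gamma> f"
  shows "\<exists>Z. has_stoch_integral_line M X \<gamma> f Z"
proof -
  have "0 < \<gamma>" using assms(1) by simp
  obtain Z where Z: "\<And>\<phi> S. (\<And>k. \<exists>a b. step_integral X a b (\<phi> k) (S k)) \<Longrightarrow>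
      Lp_tendsto lebesgue \<gamma> \<phi> f \<Longrightarrow> Lp_tendsto M 1 S Z"
    using step_integrals_converge[OF assms(3,1), of f] by auto
  define g where "g n x = indicator {- real n..real n} x *\<^sub>R f x" for n :: nat and x
  have trunc: "Lp_tendsto lebesgue \<gamma> g f"
    unfolding g_def
  proof (rule Lp_tendsto_truncation[OF assms(5) \<open>0 < \<gamma>\<close>])
    fix x :: real
    show "\<forall>\<^sub>F n in sequentially. x \<in> {- real n..real n}"
      using eventually_ge_at_top[of "nat \<lceil>\<bar>x\<bar>\<rceil>"]
      by eventually_elim (auto simp: nat_ceiling_le_eq abs_le_iff)
  qed simp
  have "has_stoch_integral_line M X \<gamma> f Z"
    unfolding has_stoch_integral_line_def
  proof (intro conjI allI impI)
    show "\<exists>Y. has_stoch_integral M X \<gamma> (- real n) (real n) f Y" for n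
      using assms by (intro has_stoch_integral_exists) auto
  next
    fix Y :: "nat \<Rightarrow> 'a \<Rightarrow> 'b"
    assume Y: "\<forall>n. has_stoch_integral M X \<gamma> (- real n) (real n) f (Y n)"
    define close where "close n \<phi> S \<longleftrightarrow> step_integral X (- real n) (real n) \<phi> S \<and> integrable M (Y n)
        \<and> (LINT x|lebesgue. norm (\<phi> x - g n x) powr \<gamma>) \<le> inverse (real (Suc n))
        \<and> (LINT \<omega>|M. norm (Y n \<omega> - S \<omega>)) \<le> inverse (real (Suc n))"
      for n and \<phi> :: "real \<Rightarrow> 'b" and S :: "'a \<Rightarrow> 'b"
    \<comment> \<open>One step function for each n that is close to the truncation and whose integral is close to
       the given version of the integral over \<open>[-n, n]\<close>.\<close>
    have "\<exists>\<phi> S. close n \<phi> S" for n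
      unfolding close_def g_def by (rule has_stoch_integral_approx[OF Y[rule_format] \<open>0 < \<gamma>\<close>]) simp
    then obtain \<phi> S where "\<And>n. close n (\<phi> n) (S n)" by metis
    then have step: "\<And>n. step_integral X (- real n) (real n) (\<phi> n) (S n)"
      and int: "\<And>n. integrable M (Y n)"
      and \<phi>: "\<And>n. (LINT x|lebesgue. norm (\<phi> n x - g n x) powr \<gamma>) \<le> inverse (real (Suc n))"
      and S: "\<And>n. (LINT \<omega>|M. norm (Y n \<omega> - S n \<omega>)) \<le> inverse (real (Suc n))"
      unfolding close_def by blast+
    have "Lp_tendsto lebesgue \<gamma> \<phi> f"
      using \<open>0 < \<gamma>\<close> trunc step_integral_Lp_mem[OF step \<open>0 < \<gamma>\<close>] \<phi> by (rule Lp_tendsto_perturb)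
    then have "Lp_tendsto M 1 S Z" using step by (intro Z) auto
    then show "Lp_tendsto M 1 Y Z"
      by (rule Lp_tendsto_perturb[rotated]) (use int S in \<open>auto simp: Lp_mem_1_iff\<close>)
  qed
  then show ?thesis by (rule exI[of _ Z])
qed

end
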